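(* Let $G=(V,E)$ be a finite connected Eulerian directed multigraph, let $\alpha$ be a probability distribution on $V$ with $\alpha_i>0$ for all $i\in V$, and let $z\in V$. For an initial sandpile $s_0:V\to\mathbb{Z}$ let $(s_k)_{k\ge 0}$ be the closed chain started at $s_0$ and driven by the i.i.d. sequence $i_1,i_2,\ldots$ with law $\alpha$, let $s_k=\rho_k+m_k\delta_z+\Delta v_k$ be the $z$-recurrent decomposition of $s_k$, and let $\tau=\tau(s_0)=\min\{k\ge 0: s_k \text{ is not stabilizable}\}$ be the threshold time. Then as $|s_0|\to-\infty$ the joint distribution of $(i_\tau,\rho_\tau,m_\tau)$ converges: $$\mathbb{P}_{s_0}\{(i_\tau,\rho_\tau,m_\tau)=(i,\rho,m)\}\;\to\;\frac{\alpha_i}{\kappa}\,\mathbf{1}\{0\le m\le |\hat a_i^{-1}\rho|-|\rho|\}.$$ Precisely: for every $\epsilon>0$ there exists $K<0$ such that for every $s_0:V\to\mathbb{Z}$ with $|s_0|<K$ and all $i\in V$, $\rho\in\mathrm{Rec}(z)$, $m\in\mathbb{N}=\{0,1,2,\ldots\}$, the left and right sides differ by at most $\epsilon$.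
   Context: Graph and Laplacian. $G=(V,E)$ is a finite directed graph, multiple edges permitted, connected and Eulerian: each vertex $i$ has the same number $\deg(i)$ of incoming edges as outgoing edges. For $u:V\to\mathbb{Z}$, $\Delta u(i)=-\deg(i)u(i)+\sum_e u(e^-)$, the sum being over edges $e$ coming into $i$, with $e^-$ the other endpoint (tail) of $e$. $\delta_i(j)=\mathbf{1}\{i=j\}$. Sandpiles. A sandpile is a function $s:V\to\mathbb{Z}$ (negative values allowed); $|s|=\sum_{i\in V}s(i)$. Vertex $i$ is unstable if $s(i)\ge\deg(i)$; toppling an unstable vertex $i$ replaces $s$ by $s+\Delta\delta_i$. $s$ is stabilizable if some finite (possibly empty) sequence of topplings of unstable vertices leads to a sandpile $\mathcal{S}(s)\le\deg-1$ (coordinatewise); $\mathcal{S}(s)$ does not depend on the sequence chosen. Closed chain. For $i\in V$, $a_i s=\mathcal{S}(s+\delta_i)$ if $s+\delta_i$ is stabilizable, and $a_i s=s+\delta_i$ otherwise. Let $i_1,i_2,\ldots$ be independent random vertices with law $\alpha$. The closed chain started from a sandpile $s_0$ is $s_k=a_{i_k}s_{k-1}$ for $k\ge1$. $\mathbb{P}_{s_0}$ is the law of the process with initial state $s_0$. Sink and recurrent sandpiles. For a vertex $z$ (the sink), $\mathcal{S}_z$ denotes stabilization in which $z$ is forbidden to topple: unstable vertices other than $z$ are toppled until no vertex of $V-\{z\}$ is unstable (this always terminates), and chips entering $z$ disappear. A sandpile $\rho$ is $z$-recurrent if $\rho(z)=\deg(z)$, $\rho(i)\le\deg(i)-1$ for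 all $i\ne z$, and every vertex of $V-\{z\}$ topples exactly once during the stabilization of $\rho+\Delta\delta_z$ with respect to $\mathcal{S}_z$. $\mathrm{Rec}(z)$ is the set of $z$-recurrent sandpiles; its cardinality $\kappa$ does not depend on $z$. Open addition operators. $\hat a_i\rho=\mathcal{S}_z(\rho+\delta_i)$, where the value at $z$ is kept equal to $\deg(z)$ (chips reaching $z$ are discarded; in particular $\hat a_z\rho=\rho$). Each $\hat a_i$ acts as a permutation of $\mathrm{Rec}(z)$, and $\hat a_i^{-1}$ denotes the inverse of this permutation. $z$-recurrent decomposition. Every sandpile $s$ can be written in exactly one way as $s=\rho+m\delta_z+\Delta v$ with $\rho\in\mathrm{Rec}(z)$, $m\in\mathbb{Z}$, $v:V\to\mathbb{Z}$ and $v(z)=0$. *)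

theory Defs
  imports "HOL-Probability.Probability" "Graph_Theory.Digraph_Component"
begin

definition eulerian :: "('v, 'e) pre_digraph \<Rightarrow> bool" where
  "eulerian G \<longleftrightarrow> (\<forall>i\<in>verts G. in_degree G i = out_degree G i)"

definition deg :: "('v, 'e) pre_digraph \<Rightarrow> 'v \<Rightarrow> int" where
  "deg G i = int (out_degree G i)"

text \<open>
  Integer functions on the vertex set are represented by extensional functions, so that equality
  of HOL functions is equality on the vertices. The vector \<open>chip i\<close> and the Laplacian \<open>lap G u\<close>
  only occur as increments; they vanish off the vertex set, so adding them preserves extensionality.
\<close>

definition vfuns :: "('v, 'e) pre_digraph \<Rightarrow> ('v \<Rightarrow> int) set" where
  "vfuns G = verts G \<rightarrow>\<^sub>E UNIV"

definition chip_count :: "('v, 'e) pre_digraph \<Rightarrow> ('v \<Rightarrow> int) \<Rightarrow> int" where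
  "chip_count G s = (\<Sum>i\<in>verts G. s i)"

definition chip :: "'v \<Rightarrow> 'v \<Rightarrow> int" where
  "chip i j = (if j = i then 1 else 0)"

definition lap :: "('v, 'e) pre_digraph \<Rightarrow> ('v \<Rightarrow> int) \<Rightarrow> 'v \<Rightarrow> int" where
  "lap G u i =
     (if i \<in> verts G then - deg G i * u i + (\<Sum>e\<in>in_arcs G i. u (tail G e)) else 0)"

text \<open>
  The set \<open>Z\<close> of sinks is empty for ordinary stabilization and \<open>{z}\<close> for stabilization
  with sink \<open>z\<close>. Sinks never topple, and chips entering a sink are discarded,
  so that the value at a sink never changes.
\<close>

definition topple :: "('v, 'e) pre_digraph \<Rightarrow> 'v set \<Rightarrow> 'v \<Rightarrow> ('v \<Rightarrow> int) \<Rightarrow> 'v \<Rightarrow> int" where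
  "topple G Z i s = (\<lambda>j. if j \<in> Z then s j else s j + lap G (chip i) j)"

primrec legal ::
  "('v, 'e) pre_digraph \<Rightarrow> 'v set \<Rightarrow> ('v \<Rightarrow> int) \<Rightarrow> 'v list \<Rightarrow> bool" where
  "legal G Z s [] \<longleftrightarrow> True"
| "legal G Z s (i # is) \<longleftrightarrow>
     i \<in> verts G - Z \<and> deg G i \<le> s i \<and> legal G Z (topple G Z i s) is"

definition stable :: "('v, 'e) pre_digraph \<Rightarrow> 'v set \<Rightarrow> ('v \<Rightarrow> int) \<Rightarrow> bool" where
  "stable G Z s \<longleftrightarrow> (\<forall>i\<in>verts G - Z. s i \<le> deg G i - 1)"

definition stabilizing ::
  "('v, 'e) pre_digraph \<Rightarrow> 'v set \<Rightarrow> ('v \<Rightarrow> int) \<Rightarrow> 'v list \<Rightarrow> bool" where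
  "stabilizing G Z s is \<longleftrightarrow> legal G Z s is \<and> stable G Z (fold (topple G Z) is s)"

definition stabilizable :: "('v, 'e) pre_digraph \<Rightarrow> ('v \<Rightarrow> int) \<Rightarrow> bool" where
  "stabilizable G s \<longleftrightarrow> (\<exists>is. stabilizing G {} s is)"

definition stabilization ::
  "('v, 'e) pre_digraph \<Rightarrow> 'v set \<Rightarrow> ('v \<Rightarrow> int) \<Rightarrow> 'v \<Rightarrow> int" where
  "stabilization G Z s = (THE t. \<exists>is. stabilizing G Z s is \<and> t = fold (topple G Z) is s)"

definition add_chip :: "('v, 'e) pre_digraph \<Rightarrow> 'v \<Rightarrow> ('v \<Rightarrow> int) \<Rightarrow> 'v \<Rightarrow> int" where
  "add_chip G i s =
     (let t = (\<lambda>j. s j + chip i j) in if stabilizable G t then stabilization G {} t else t)"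

text \<open>The vertex \<open>x k\<close> receives the \<open>k\<close>-th chip for \<open>k \<ge> 1\<close>; the value \<open>x 0\<close> is not used.\<close>

primrec closed_chain ::
  "('v, 'e) pre_digraph \<Rightarrow> ('v \<Rightarrow> int) \<Rightarrow> (nat \<Rightarrow> 'v) \<Rightarrow> nat \<Rightarrow> 'v \<Rightarrow> int" where
  "closed_chain G s\<^sub>0 x 0 = s\<^sub>0"
| "closed_chain G s\<^sub>0 x (Suc k) = add_chip G (x (Suc k)) (closed_chain G s\<^sub>0 x k)"

definition threshold_time ::
  "('v, 'e) pre_digraph \<Rightarrow> ('v \<Rightarrow> int) \<Rightarrow> (nat \<Rightarrow> 'v) \<Rightarrow> nat" where
  "threshold_time G s\<^sub>0 x = (LEAST k. \<not> stabilizable G (closed_chain G s\<^sub>0 x k))"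

definition threshold_state ::
  "('v, 'e) pre_digraph \<Rightarrow> ('v \<Rightarrow> int) \<Rightarrow> (nat \<Rightarrow> 'v) \<Rightarrow> 'v \<Rightarrow> int" where
  "threshold_state G s\<^sub>0 x = closed_chain G s\<^sub>0 x (threshold_time G s\<^sub>0 x)"

definition Rec :: "('v, 'e) pre_digraph \<Rightarrow> 'v \<Rightarrow> ('v \<Rightarrow> int) set" where
  "Rec G z =
     {\<rho> \<in> vfuns G. \<rho> z = deg G z \<and> (\<forall>i\<in>verts G - {z}. \<rho> i \<le> deg G i - 1) \<and>
        (\<exists>is. stabilizing G {z} (\<lambda>j. \<rho> j + lap G (chip z) j) is \<and>
              (\<forall>i\<in>verts G - {z}. count_list is i = 1))}"

text \<open>Resetting the value at \<open>z\<close> only matters for \<open>i = z\<close>, where the added chip is discarded.\<close>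

definition open_add :: "('v, 'e) pre_digraph \<Rightarrow> 'v \<Rightarrow> 'v \<Rightarrow> ('v \<Rightarrow> int) \<Rightarrow> 'v \<Rightarrow> int" where
  "open_add G z i \<rho> = (stabilization G {z} (\<lambda>j. \<rho> j + chip i j))(z := deg G z)"

definition open_add_inv :: "('v, 'e) pre_digraph \<Rightarrow> 'v \<Rightarrow> 'v \<Rightarrow> ('v \<Rightarrow> int) \<Rightarrow> 'v \<Rightarrow> int" where
  "open_add_inv G z i = inv_into (Rec G z) (open_add G z i)"

definition rec_decomp ::
  "('v, 'e) pre_digraph \<Rightarrow> 'v \<Rightarrow> ('v \<Rightarrow> int) \<Rightarrow> ('v \<Rightarrow> int) \<times> int \<times> ('v \<Rightarrow> int)" where
  "rec_decomp G z s =
     (THE (\<rho>, m, v). \<rho> \<in> Rec G z \<and> v \<in> vfuns G \<and> v z = 0 \<and>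
        s = (\<lambda>j. \<rho> j + m * chip z j + lap G v j))"

definition rec_part :: "('v, 'e) pre_digraph \<Rightarrow> 'v \<Rightarrow> ('v \<Rightarrow> int) \<Rightarrow> 'v \<Rightarrow> int" where
  "rec_part G z s = fst (rec_decomp G z s)"

definition sink_part :: "('v, 'e) pre_digraph \<Rightarrow> 'v \<Rightarrow> ('v \<Rightarrow> int) \<Rightarrow> int" where
  "sink_part G z s = fst (snd (rec_decomp G z s))"

end

theory Submission
  imports Defs
begin

text \<open>
  Toppling only adds Laplacians, so modulo the image of \<open>\<Delta>\<close> the closed chain is
  \<open>s\<^sub>0 + \<delta>(i\<^sub>1) + \<dots> + \<delta>(i\<^sub>k)\<close>, whichever topplings took place. Its recurrent decomposition therefore
  evolves autonomously: \<open>\<rho>\<^sub>k\<close> arises from \<open>\<rho>\<^sub>0\<close> by the open addition operators of \<open>i\<^sub>1, \<dots>, i\<^sub>k\<close>, and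
  conservation of chips gives \<open>m\<^sub>k = |s\<^sub>0| + k - |\<rho>\<^sub>k|\<close> (\<open>rec_rep_closed_chain\<close>). The
  sequence \<open>m\<^sub>k\<close> is nondecreasing, since adding a chip in the open model can only lose chips into
  the sink, and \<open>s\<^sub>k\<close> is stabilizable exactly when \<open>m\<^sub>k < 0\<close> (\<open>stabilizable_iff_rep\<close>).

  Consequently, if \<open>\<rho>\<^sub>\<tau> = \<rho>\<close> and \<open>m\<^sub>\<tau> = m\<close>, then \<open>\<tau> = |\<rho>| + m - |s\<^sub>0|\<close>: once the target state is
  fixed, the threshold time is not random. With \<open>n = \<tau> - 1\<close>, the event
  \<open>(i\<^sub>\<tau>, \<rho>\<^sub>\<tau>, m\<^sub>\<tau>) = (i, \<rho>, m)\<close> says that \<open>i\<close> is drawn at the fixed time \<open>n + 1\<close>, that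
  \<open>\<rho>\<^sub>n\<close> is the preimage \<open>\<rho>'\<close> of \<open>\<rho>\<close> under the operator of \<open>i\<close>, and that \<open>m\<^sub>n < 0\<close>; the last condition
  amounts to \<open>m \<le> |\<rho>'| - |\<rho>|\<close> (\<open>threshold_event_iff\<close>). By independence the probability is
  \<open>\<alpha>\<^sub>i P(\<rho>\<^sub>n = \<rho>')\<close>. As \<open>|s\<^sub>0| \<rightarrow> -\<infinity>\<close> also \<open>n \<rightarrow> \<infinity>\<close>, and \<open>\<rho>\<^sub>n\<close> is a random walk
  by permutations of the finite set of recurrent sandpiles. The walk is transitive, and the operator
  of the sink is the identity, so that it is aperiodic; hence it converges to the uniform distribution
  at a rate that is uniform in the starting point (\<open>visit_prob_tendsto_uniform\<close>).

  The sandpile theory behind this rests on two facts. The least action principle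
  (\<open>least_action\<close>) turns stabilizability into solvability of \<open>s + \<Delta>w \<le> deg - 1\<close>. Dhar's burning
  criterion (\<open>Rec_iff\<close>) describes recurrence by the absence of forbidden subsets; applied to the set
  where a function \<open>w\<close> is minimal, it yields both the uniqueness of the decomposition and the
  criterion for stabilizability.

  There is also a measure-theoretic point. The driving variables take values in the vertex set only
  almost surely, and the underlying measure need not be complete, so that the threshold event has to be
  shown measurable also on the paths that leave the vertex set (\<open>threshold_event_sets\<close>).
\<close>

lemma exists_list_with_counts:
  assumes "finite A"
  shows "\<exists>xs. set xs \<subseteq> A \<and> (\<forall>a\<in>A. count_list xs a = n a)"
  using assms
proof (induction A)
  case empty
  then show ?case by simp
next
  case (insert x A)
  then obtain xs where xs: "set xs \<subseteq> A" "\<forall>a\<in>A. count_list xs a = n a" by blast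
  then have "count_list xs x = 0" using insert.hyps by (auto simp: count_list_0_iff)
  moreover have "count_list (replicate k x) a = (if a = x then k else 0)" for k a
    by (induction k) auto
  ultimately show ?case
    using xs insert.hyps
    by (intro exI[of _ "replicate (n x) x @ xs"]) (auto split: if_splits)
qed

lemma count_list_distinct: "distinct xs \<Longrightarrow> count_list xs x = (if x \<in> set xs then 1 else 0)"
  by (induction xs) auto

section \<open>Random walks driven by permutations\<close>

text \<open>
  A step of the walk applies the permutation \<open>a i\<close> of \<open>R\<close> with probability \<open>p i\<close>. The letter \<open>e\<close>
  with its trivial action makes the walk lazy and thereby excludes periodicity.
\<close>

locale permutation_walk =
  fixes V :: "'i set" and p :: "'i \<Rightarrow> real" and R :: "'r set" and a :: "'i \<Rightarrow> 'r \<Rightarrow> 'r" and e :: 'i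
  assumes finite_V: "finite V" and finite_R: "finite R" and R_nonempty: "R \<noteq> {}"
    and p_pos: "\<And>i. i \<in> V \<Longrightarrow> 0 < p i" and p_sum: "sum p V = 1"
    and bij: "\<And>i. i \<in> V \<Longrightarrow> bij_betw (a i) R R"
    and transitive: "\<And>\<rho> \<sigma>. \<rho> \<in> R \<Longrightarrow> \<sigma> \<in> R \<Longrightarrow> \<exists>xs. set xs \<subseteq> V \<and> fold a xs \<rho> = \<sigma>"
    and e_in_V: "e \<in> V" and idle: "\<And>\<rho>. \<rho> \<in> R \<Longrightarrow> a e \<rho> = \<rho>"
begin

text \<open>
  The transition operator of the walk, acting on functions of the starting point.
\<close>

definition avg :: "('r \<Rightarrow> real) \<Rightarrow> 'r \<Rightarrow> real" where
  "avg f \<rho> = (\<Sum>i\<in>V. p i * f (a i \<rho>))"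

text \<open>
  The probability of being at \<open>\<sigma>\<close> after \<open>n\<close> steps, as a function of the starting point. This backward
  form has the advantage that its dependence on the starting point, which is what has to die out,
  is governed by the averaging operator alone.
\<close>

definition visit_prob :: "'r \<Rightarrow> nat \<Rightarrow> 'r \<Rightarrow> real" where
  "visit_prob \<sigma> n = (avg ^^ n) (\<lambda>\<rho>. if \<rho> = \<sigma> then 1 else 0)"

lemma a_in_R: "i \<in> V \<Longrightarrow> \<rho> \<in> R \<Longrightarrow> a i \<rho> \<in> R"
  using bij bij_betwE by blast

lemma avg_ge:
  assumes "\<And>\<rho>. \<rho> \<in> R \<Longrightarrow> c \<le> f \<rho>" "\<rho> \<in> R"
  shows "c \<le> avg f \<rho>"
proof -
  have "c = (\<Sum>i\<in>V. p i * c)" by (simp add: p_sum flip: sum_distrib_right)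
  also have "\<dots> \<le> avg f \<rho>"
    unfolding avg_def using assms p_pos a_in_R by (intro sum_mono mult_left_mono) (auto simp: less_imp_le)
  finally show ?thesis .
qed

lemma avg_le:
  assumes "\<And>\<rho>. \<rho> \<in> R \<Longrightarrow> f \<rho> \<le> c" "\<rho> \<in> R"
  shows "avg f \<rho> \<le> c"
  using avg_ge[of "- c" "\<lambda>\<rho>. - f \<rho>" \<rho>] assms by (simp add: avg_def sum_negf)

lemma avg_pow_ge: "(\<And>\<rho>. \<rho> \<in> R \<Longrightarrow> c \<le> f \<rho>) \<Longrightarrow> \<rho> \<in> R \<Longrightarrow> c \<le> (avg ^^ n) f \<rho>"
  by (induction n arbitrary: \<rho>) (auto intro: avg_ge)

lemma avg_pow_le: "(\<And>\<rho>. \<rho> \<in> R \<Longrightarrow> f \<rho> \<le> c) \<Longrightarrow> \<rho> \<in> R \<Longrightarrow> (avg ^^ n) f \<rho> \<le> c"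
  by (induction n arbitrary: \<rho>) (auto intro: avg_le)

text \<open>
  The word \<open>xs\<close> is followed with probability at least \<open>d ^ length xs\<close>; on the remaining paths \<open>c\<close>
  bounds the function from below.
\<close>

lemma avg_pow_ge_along_word:
  assumes d: "0 \<le> d" "\<And>i. i \<in> V \<Longrightarrow> d \<le> p i" and c: "\<And>\<rho>. \<rho> \<in> R \<Longrightarrow> c \<le> f \<rho>"
    and \<rho>: "\<rho> \<in> R" and xs: "set xs \<subseteq> V"
  shows "c + d ^ length xs * (f (fold a xs \<rho>) - c) \<le> (avg ^^ length xs) f \<rho>"
  using \<rho> xs
proof (induction xs arbitrary: \<rho>)
  case Nil
  then show ?case by simp
next
  case (Cons i xs)
  let ?g = "(avg ^^ length xs) f" and ?t = "f (fold a xs (a i \<rho>)) - c"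
  have i: "i \<in> V" using Cons.prems by simp
  have nonneg: "0 \<le> p j * (?g (a j \<rho>) - c)" if "j \<in> V" for j
    using p_pos[OF that] avg_pow_ge[OF c a_in_R[OF that Cons.prems(1)]]
    by (intro mult_nonneg_nonneg) (auto simp: less_imp_le)
  have in_R: "set ys \<subseteq> V \<Longrightarrow> \<sigma> \<in> R \<Longrightarrow> fold a ys \<sigma> \<in> R" for ys \<sigma>
    by (induction ys arbitrary: \<sigma>) (auto simp: a_in_R)
  have t: "0 \<le> ?t" using c[OF in_R] i a_in_R Cons.prems by simp
  have IH: "d ^ length xs * ?t \<le> ?g (a i \<rho>) - c"
    using Cons.IH[of "a i \<rho>"] i a_in_R Cons.prems by simp
  have "d ^ Suc (length xs) * ?t = d * (d ^ length xs * ?t)" by simp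
  also have "\<dots> \<le> p i * (?g (a i \<rho>) - c)"
    using d i t IH p_pos[OF i] by (intro mult_mono) (auto intro!: mult_nonneg_nonneg)
  also have "\<dots> \<le> (\<Sum>j\<in>V. p j * (?g (a j \<rho>) - c))"
    using nonneg i finite_V by (intro member_le_sum) auto
  also have "\<dots> = avg ?g \<rho> - c"
    by (simp add: avg_def right_diff_distrib sum_subtractf p_sum flip: sum_distrib_right)
  finally show ?case by simp
qed

text \<open>
  Words of different lengths are padded with the idle letter.
\<close>

lemma uniform_word_length:
  "\<exists>N. \<forall>\<rho>\<in>R. \<forall>\<sigma>\<in>R. \<exists>xs. set xs \<subseteq> V \<and> length xs = N \<and> fold a xs \<rho> = \<sigma>"
proof -
  have "\<forall>q\<in>R \<times> R. \<exists>xs. set xs \<subseteq> V \<and> fold a xs (fst q) = snd q" using transitive by auto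
  then obtain w where w: "\<forall>q\<in>R \<times> R. set (w q) \<subseteq> V \<and> fold a (w q) (fst q) = snd q"
    by (rule bchoice[THEN exE])
  define N where "N = Max ((\<lambda>q. length (w q)) ` (R \<times> R))"
  have pad: "fold a (replicate k e) \<sigma> = \<sigma>" if "\<sigma> \<in> R" for k \<sigma>
    using that by (induction k) (simp_all add: idle)
  show ?thesis
  proof (intro exI[of _ N] ballI)
    fix \<rho> \<sigma> assume q: "\<rho> \<in> R" "\<sigma> \<in> R"
    have "length (w (\<rho>, \<sigma>)) \<le> N" unfolding N_def using q finite_R by (intro Max_ge) auto
    moreover have "set (w (\<rho>, \<sigma>)) \<subseteq> V" "fold a (w (\<rho>, \<sigma>)) \<rho> = \<sigma>"
      using bspec[OF w, of "(\<rho>, \<sigma>)"] q by auto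
    ultimately show "\<exists>xs. set xs \<subseteq> V \<and> length xs = N \<and> fold a xs \<rho> = \<sigma>"
      using pad[OF q(2)] e_in_V
      by (intro exI[of _ "w (\<rho>, \<sigma>) @ replicate (N - length (w (\<rho>, \<sigma>))) e"]) auto
  qed
qed

definition osc_le :: "real \<Rightarrow> ('r \<Rightarrow> real) \<Rightarrow> bool" where
  "osc_le K f \<longleftrightarrow> (\<forall>\<rho>\<in>R. \<forall>\<sigma>\<in>R. f \<rho> - f \<sigma> \<le> K)"

lemma extrema:
  fixes f :: "'r \<Rightarrow> real"
  obtains \<rho> \<sigma> where "\<rho> \<in> R" "\<sigma> \<in> R" "\<And>\<tau>. \<tau> \<in> R \<Longrightarrow> f \<rho> \<le> f \<tau>" "\<And>\<tau>. \<tau> \<in> R \<Longrightarrow> f \<tau> \<le> f \<sigma>"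
proof -
  have fin: "finite (f ` R)" "f ` R \<noteq> {}" using finite_R R_nonempty by auto
  obtain \<rho> where "\<rho> \<in> R" "f \<rho> = Min (f ` R)" using Min_in[OF fin] by auto
  moreover obtain \<sigma> where "\<sigma> \<in> R" "f \<sigma> = Max (f ` R)" using Max_in[OF fin] by auto
  moreover have "Min (f ` R) \<le> f \<tau>" "f \<tau> \<le> Max (f ` R)" if "\<tau> \<in> R" for \<tau>
    using fin(1) that by simp_all
  ultimately show thesis by (intro that[of \<rho> \<sigma>]) simp_all
qed

lemma osc_avg_pow:
  assumes "osc_le K f"
  shows "osc_le K ((avg ^^ n) f)"
proof -
  obtain \<rho> \<sigma> where e: "\<rho> \<in> R" "\<sigma> \<in> R" "\<And>\<tau>. \<tau> \<in> R \<Longrightarrow> f \<rho> \<le> f \<tau>" "\<And>\<tau>. \<tau> \<in> R \<Longrightarrow> f \<tau> \<le> f \<sigma>"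
    by (rule extrema[of f]) blast
  have "f \<sigma> - f \<rho> \<le> K" using assms e(1,2) by (simp add: osc_le_def)
  then show ?thesis
    unfolding osc_le_def using avg_pow_ge[OF e(3), where n = n] avg_pow_le[OF e(4), where n = n] by force
qed

text \<open>
  A Doeblin argument: from every starting point the walk sits, after \<open>N\<close> steps and with probability at
  least \<open>\<delta>\<close>, at a point where \<open>f\<close> is maximal. This lifts the minimum by a fixed
  proportion of the oscillation.
\<close>

lemma osc_contraction:
  "\<exists>N \<delta>. 0 < \<delta> \<and> \<delta> \<le> 1 \<and> (\<forall>K f. osc_le K f \<longrightarrow> osc_le ((1 - \<delta>) * K) ((avg ^^ N) f))"
proof -
  obtain N where N: "\<forall>\<rho>\<in>R. \<forall>\<sigma>\<in>R. \<exists>xs. set xs \<subseteq> V \<and> length xs = N \<and> fold a xs \<rho> = \<sigma>"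
    using uniform_word_length by blast
  define d where "d = Min (p ` V)"
  have d: "d \<le> p i" if "i \<in> V" for i using that finite_V by (simp add: d_def)
  have "d \<in> p ` V" unfolding d_def using finite_V e_in_V by (intro Min_in) auto
  then have d0: "0 < d" using p_pos by auto
  have "p e \<le> sum p V" using finite_V e_in_V p_pos by (intro member_le_sum) (auto simp: less_imp_le)
  then have d1: "d \<le> 1" using d[OF e_in_V] p_sum by simp
  have "osc_le ((1 - d ^ N) * K) ((avg ^^ N) f)" if K: "osc_le K f" for K f
  proof -
    obtain \<rho> \<sigma> where e: "\<rho> \<in> R" "\<sigma> \<in> R" "\<And>\<tau>. \<tau> \<in> R \<Longrightarrow> f \<rho> \<le> f \<tau>" "\<And>\<tau>. \<tau> \<in> R \<Longrightarrow> f \<tau> \<le> f \<sigma>"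
      by (rule extrema[of f]) blast
    have lower: "f \<rho> + d ^ N * (f \<sigma> - f \<rho>) \<le> (avg ^^ N) f \<tau>" if \<tau>: "\<tau> \<in> R" for \<tau>
    proof -
      obtain xs where "set xs \<subseteq> V" "length xs = N" "fold a xs \<tau> = \<sigma>" using N \<tau> e(2) by blast
      then show ?thesis using avg_pow_ge_along_word[of d "f \<rho>" f \<tau> xs] d d0 e(3) \<tau> by simp
    qed
    have upper: "(avg ^^ N) f \<tau> \<le> f \<sigma>" if "\<tau> \<in> R" for \<tau>
      using that e(4) by (rule avg_pow_le[rotated])
    have "(1 - d ^ N) * (f \<sigma> - f \<rho>) \<le> (1 - d ^ N) * K"
      using K e(1,2) d0 d1 by (intro mult_left_mono) (auto simp: osc_le_def power_le_one)
    moreover have "(avg ^^ N) f \<tau> - (avg ^^ N) f \<tau>' \<le> (1 - d ^ N) * (f \<sigma> - f \<rho>)"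
      if "\<tau> \<in> R" "\<tau>' \<in> R" for \<tau> \<tau>'
      using lower[OF that(2)] upper[OF that(1)] by (simp add: algebra_simps)
    ultimately show ?thesis unfolding osc_le_def by fastforce
  qed
  then show ?thesis
    using d0 d1 by (intro exI[of _ N] exI[of _ "d ^ N"]) (auto simp: power_le_one)
qed

text \<open>
  Permutations preserve the counting measure, which is why the limit is uniform.
\<close>

lemma sum_avg_pow: "(\<Sum>\<rho>\<in>R. (avg ^^ n) f \<rho>) = (\<Sum>\<rho>\<in>R. f \<rho>)"
proof (induction n)
  case (Suc n)
  let ?g = "(avg ^^ n) f"
  have "(\<Sum>\<rho>\<in>R. avg ?g \<rho>) = (\<Sum>i\<in>V. \<Sum>\<rho>\<in>R. p i * ?g (a i \<rho>))"
    unfolding avg_def by (rule sum.swap)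
  also have "\<dots> = (\<Sum>i\<in>V. p i * (\<Sum>\<rho>\<in>R. ?g \<rho>))"
    using bij by (intro sum.cong refl) (simp add: sum.reindex_bij_betw flip: sum_distrib_left)
  also have "\<dots> = (\<Sum>\<rho>\<in>R. ?g \<rho>)" by (simp add: p_sum flip: sum_distrib_right)
  finally show ?case using Suc.IH by simp
qed simp

theorem visit_prob_tendsto_uniform:
  assumes "0 < \<epsilon>"
  shows "\<exists>n0. \<forall>n\<ge>n0. \<forall>\<sigma>\<in>R. \<forall>\<rho>\<in>R. \<bar>visit_prob \<sigma> n \<rho> - 1 / card R\<bar> \<le> \<epsilon>"
proof -
  obtain N \<delta> where \<delta>: "0 < \<delta>" "\<delta> \<le> 1"
    and contr: "\<And>K f. osc_le K f \<Longrightarrow> osc_le ((1 - \<delta>) * K) ((avg ^^ N) f)"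
    using osc_contraction by blast
  obtain k where k: "(1 - \<delta>) ^ k < \<epsilon>" using real_arch_pow_inv[of \<epsilon> "1 - \<delta>"] assms \<delta> by auto
  have iter: "osc_le ((1 - \<delta>) ^ k) ((avg ^^ (N * k)) f)" if "osc_le 1 f" for f k
  proof (induction k)
    case (Suc k)
    from contr[OF Suc] show ?case by (simp add: funpow_add)
  qed (use that in simp)
  show ?thesis
  proof (intro exI[of _ "N * k"] allI impI ballI)
    fix n \<sigma> \<rho> assume n: "N * k \<le> n" and \<sigma>: "\<sigma> \<in> R" and \<rho>: "\<rho> \<in> R"
    define f where "f = visit_prob \<sigma> n"
    have "osc_le 1 (\<lambda>\<rho>. if \<rho> = \<sigma> then 1 else 0)" by (simp add: osc_le_def)
    from osc_avg_pow[OF iter[OF this, of k], of "n - N * k"]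
    have "osc_le ((1 - \<delta>) ^ k) f"
      unfolding f_def visit_prob_def using n by (simp flip: funpow_add comp_apply[of "_ ^^ _"])
    then have osc: "\<bar>f \<rho> - f \<tau>\<bar> \<le> \<epsilon>" if "\<tau> \<in> R" for \<tau>
      using k \<rho> that unfolding osc_le_def by (fastforce simp: abs_le_iff)
    have total: "(\<Sum>\<tau>\<in>R. f \<tau>) = 1"
      unfolding f_def visit_prob_def sum_avg_pow using \<sigma> finite_R by simp
    have card: "0 < real (card R)" using finite_R R_nonempty by (simp add: card_gt_0_iff)
    have "real (card R) * (f \<rho> - 1 / card R) = (\<Sum>\<tau>\<in>R. f \<rho> - f \<tau>)"
      using card by (simp add: sum_subtractf total right_diff_distrib)
    then have "real (card R) * \<bar>f \<rho> - 1 / card R\<bar> = \<bar>\<Sum>\<tau>\<in>R. f \<rho> - f \<tau>\<bar>"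
      by (metis abs_mult abs_of_nat)
    also have "\<dots> \<le> (\<Sum>\<tau>\<in>R. \<epsilon>)" using osc by (intro order_trans[OF sum_abs] sum_mono)
    also have "\<dots> = real (card R) * \<epsilon>" by simp
    finally show "\<bar>visit_prob \<sigma> n \<rho> - 1 / card R\<bar> \<le> \<epsilon>" using card by (simp add: f_def)
  qed
qed

lemma visit_prob_eq_sum_words:
  "visit_prob \<sigma> n \<rho> = (\<Sum>xs\<in>{xs. set xs \<subseteq> V \<and> length xs = n}.
     if fold a xs \<rho> = \<sigma> then prod_list (map p xs) else 0)"
proof (induction n arbitrary: \<rho>)
  case 0
  have "{xs. set xs \<subseteq> V \<and> length xs = 0} = {[]}" by auto
  then show ?case by (simp add: visit_prob_def)
next
  case (Suc n)
  let ?W = "{xs. set xs \<subseteq> V \<and> length xs = n}"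
  have "(\<Sum>xs\<in>{xs. set xs \<subseteq> V \<and> length xs = Suc n}. if fold a xs \<rho> = \<sigma> then prod_list (map p xs) else 0)
      = (\<Sum>(xs, i)\<in>?W \<times> V. p i * (if fold a xs (a i \<rho>) = \<sigma> then prod_list (map p xs) else 0))"
    unfolding lists_length_Suc_eq
    by (subst sum.reindex) (auto simp: inj_on_def intro!: sum.cong)
  also have "\<dots> = (\<Sum>xs\<in>?W. \<Sum>i\<in>V. p i * (if fold a xs (a i \<rho>) = \<sigma> then prod_list (map p xs) else 0))"
    by (rule sum.cartesian_product[symmetric])
  also have "\<dots> = (\<Sum>i\<in>V. \<Sum>xs\<in>?W. p i * (if fold a xs (a i \<rho>) = \<sigma> then prod_list (map p xs) else 0))"
    by (rule sum.swap)
  also have "\<dots> = (\<Sum>i\<in>V. p i * visit_prob \<sigma> n (a i \<rho>))"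
    by (simp only: Suc.IH sum_distrib_left)
  also have "\<dots> = visit_prob \<sigma> (Suc n) \<rho>" by (simp add: visit_prob_def avg_def)
  finally show ?case ..
qed

end

section \<open>The Laplacian of an Eulerian digraph\<close>

text \<open>
  The number of arcs from \<open>S\<close> into \<open>i\<close>, with multiplicity. These numbers describe both the chips that \<open>i\<close>
  receives when \<open>S\<close> is toppled and, because the digraph is Eulerian, the number of chips that \<open>i\<close> in \<open>S\<close>
  needs in order to become unstable once everything outside \<open>S\<close> has toppled.
\<close>

definition in_from :: "('v, 'e) pre_digraph \<Rightarrow> 'v set \<Rightarrow> 'v \<Rightarrow> int" where
  "in_from G S i = int (card {e \<in> in_arcs G i. tail G e \<in> S})"

locale eulerian_digraph = fin_digraph G for G :: "('v, 'e) pre_digraph" +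
  assumes connected_G: "Digraph_Component.connected G"
    and eulerian_G: "eulerian G"
begin

lemma finite_in_arcs [simp]: "finite (in_arcs G i)"
  by (simp add: in_arcs_def)

lemma deg_eq_card_in_arcs: "i \<in> verts G \<Longrightarrow> deg G i = int (card (in_arcs G i))"
  using eulerian_G by (simp add: deg_def eulerian_def in_degree_def)

lemma lap_outside: "i \<notin> verts G \<Longrightarrow> lap G u i = 0"
  by (simp add: lap_def)

text \<open>
  Since the degree counts the incoming arcs, the Laplacian is a sum of differences. This is the form in
  which maximum principles become visible.
\<close>

lemma lap_eq_sum_diff:
  "i \<in> verts G \<Longrightarrow> lap G u i = (\<Sum>e\<in>in_arcs G i. u (tail G e) - u i)"
  by (simp add: lap_def deg_eq_card_in_arcs sum_subtractf)

lemma lap_cong: "(\<And>i. i \<in> verts G \<Longrightarrow> u i = v i) \<Longrightarrow> lap G u = lap G v"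
  by (rule ext) (auto simp: lap_def in_arcs_def intro!: sum.cong)

lemma lap_add: "lap G (\<lambda>i. u i + v i) j = lap G u j + lap G v j"
  by (simp add: lap_def sum.distrib algebra_simps)

lemma lap_uminus: "lap G (\<lambda>i. - u i) j = - lap G u j"
  by (simp add: lap_def sum_negf)

lemma lap_diff: "lap G (\<lambda>i. u i - v i) j = lap G u j - lap G v j"
  by (simp add: lap_def sum_subtractf algebra_simps)

lemma lap_scale: "lap G (\<lambda>i. c * u i) j = c * lap G u j"
  by (simp add: lap_def sum_distrib_left algebra_simps)

lemma lap_const: "lap G (\<lambda>i. c) j = 0"
  by (cases "j \<in> verts G") (simp_all add: lap_eq_sum_diff lap_outside)

lemma sum_in_arcs: "(\<Sum>i\<in>verts G. \<Sum>e\<in>in_arcs G i. f e) = (\<Sum>e\<in>arcs G. f e)" for f :: "'e \<Rightarrow> int"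
proof -
  have "(\<Sum>i\<in>verts G. \<Sum>e\<in>in_arcs G i. f e) = (\<Sum>i\<in>verts G. \<Sum>e\<in>{e \<in> arcs G. head G e = i}. f e)"
    by (simp add: in_arcs_def)
  also have "\<dots> = (\<Sum>e\<in>arcs G. f e)"
    by (rule sum.group) auto
  finally show ?thesis .
qed

lemma sum_out_arcs: "(\<Sum>e\<in>arcs G. u (tail G e)) = (\<Sum>i\<in>verts G. deg G i * u i)" for u :: "'v \<Rightarrow> int"
proof -
  have "(\<Sum>e\<in>arcs G. u (tail G e)) = (\<Sum>i\<in>verts G. \<Sum>e\<in>{e \<in> arcs G. tail G e = i}. u (tail G e))"
    by (rule sum.group[symmetric]) auto
  also have "\<dots> = (\<Sum>i\<in>verts G. deg G i * u i)"
    by (intro sum.cong) (auto simp: deg_def out_degree_def out_arcs_def)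
  finally show ?thesis .
qed

lemma chip_count_lap: "chip_count G (lap G u) = 0"
proof -
  have "chip_count G (lap G u) = (\<Sum>i\<in>verts G. - deg G i * u i + (\<Sum>e\<in>in_arcs G i. u (tail G e)))"
    by (simp add: chip_count_def lap_def)
  also have "\<dots> = 0"
    by (simp add: sum_subtractf sum_in_arcs sum_out_arcs)
  finally show ?thesis .
qed

lemma chip_count_add: "chip_count G (\<lambda>i. s i + t i) = chip_count G s + chip_count G t"
  by (simp add: chip_count_def sum.distrib)

lemma chip_count_chip: "z \<in> verts G \<Longrightarrow> chip_count G (\<lambda>i. m * chip z i) = m"
  by (simp add: chip_count_def chip_def if_distrib sum.delta cong: if_cong)

lemma lap_mono_at:
  assumes "\<And>i. i \<in> verts G \<Longrightarrow> u i \<le> v i" and "u j = v j"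
  shows "lap G u j \<le> lap G v j"
proof (cases "j \<in> verts G")
  case True
  have "(\<Sum>e\<in>in_arcs G j. u (tail G e) - u j) \<le> (\<Sum>e\<in>in_arcs G j. v (tail G e) - v j)"
    using assms by (intro sum_mono) (auto simp: in_arcs_def)
  then show ?thesis using True by (simp add: lap_eq_sum_diff)
qed (simp add: lap_outside)

lemma in_from_nonneg: "0 \<le> in_from G S i"
  by (simp add: in_from_def)

lemma in_from_mono: "S \<subseteq> T \<Longrightarrow> in_from G S i \<le> in_from G T i"
  unfolding in_from_def by (simp, rule card_mono) auto

lemma in_from_eq_sum: "in_from G S i = (\<Sum>e\<in>in_arcs G i. if tail G e \<in> S then 1 else 0)"
  by (simp add: in_from_def sum.inter_filter[symmetric])

lemma in_from_le_deg: "i \<in> verts G \<Longrightarrow> in_from G S i \<le> deg G i"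
  unfolding in_from_def deg_eq_card_in_arcs by (simp, rule card_mono) auto

text \<open>
  At a minimum of an integer function, each arc that comes from outside the set of minimizers contributes at
  least one.
\<close>

lemma lap_at_argmin:
  assumes i: "i \<in> S" "i \<in> verts G" and S: "S = {j \<in> verts G. \<forall>k\<in>verts G. w j \<le> w k}"
  shows "lap G w i \<ge> deg G i - in_from G S i"
proof -
  have "deg G i - in_from G S i = (\<Sum>e\<in>in_arcs G i. 1 - (if tail G e \<in> S then 1 else 0))"
    using i(2) by (simp add: deg_eq_card_in_arcs in_from_eq_sum sum_subtractf)
  also have "\<dots> \<le> (\<Sum>e\<in>in_arcs G i. w (tail G e) - w i)"
  proof (rule sum_mono)
    fix e assume "e \<in> in_arcs G i"
    then have t: "tail G e \<in> verts G" by (auto simp: in_arcs_def)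
    have le: "w i \<le> w (tail G e)" using t i S by auto
    show "1 - (if tail G e \<in> S then 1 else 0) \<le> w (tail G e) - w i"
    proof (cases "tail G e \<in> S")
      case False
      then obtain k where "k \<in> verts G" "w k < w (tail G e)" using S t by force
      moreover have "w i \<le> w k" using i S \<open>k \<in> verts G\<close> by auto
      ultimately show ?thesis using False by simp
    qed (use le in simp)
  qed
  finally show ?thesis using i(2) by (simp add: lap_eq_sum_diff)
qed

section \<open>Connectivity and a strictly superharmonic function\<close>

text \<open>
  In an Eulerian digraph as many arcs enter \<open>S\<close> as leave it. A set that no arc leaves is hence not entered
  either, and the connectedness of the undirected graph forces it to be everything. In particular, weak
  connectedness already gives directed paths.
\<close>

lemma exists_arc_leaving:
  assumes S: "S \<subseteq> verts G" "S \<noteq> {}" "S \<noteq> verts G"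
  obtains e where "e \<in> arcs G" "tail G e \<in> S" "head G e \<notin> S"
proof (rule ccontr)
  assume "\<not> thesis"
  then have closed: "\<And>e. e \<in> arcs G \<Longrightarrow> tail G e \<in> S \<Longrightarrow> head G e \<in> S"
    using that by blast
  define I where "I i = (if i \<in> S then 1 else 0 :: int)" for i
  have "(\<Sum>e\<in>arcs G. I (head G e)) = (\<Sum>i\<in>verts G. \<Sum>e\<in>in_arcs G i. I (head G e))"
    by (rule sum_in_arcs[symmetric])
  also have "\<dots> = (\<Sum>i\<in>verts G. deg G i * I i)"
    by (intro sum.cong refl) (simp add: deg_eq_card_in_arcs in_arcs_def)
  also have "\<dots> = (\<Sum>e\<in>arcs G. I (tail G e))"
    by (rule sum_out_arcs[symmetric])
  finally have "(\<Sum>e\<in>arcs G. I (head G e) - I (tail G e)) = 0"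
    by (simp add: sum_subtractf)
  moreover have "\<And>e. e \<in> arcs G \<Longrightarrow> 0 \<le> I (head G e) - I (tail G e)"
    using closed by (auto simp: I_def)
  ultimately have eq: "\<And>e. e \<in> arcs G \<Longrightarrow> I (head G e) - I (tail G e) = 0"
    by (subst (asm) sum_nonneg_eq_0_iff) auto
  obtain a b where a: "a \<in> S" and b: "b \<in> verts G" "b \<notin> S"
    using S by auto
  have "a \<rightarrow>\<^sup>*\<^bsub>mk_symmetric G\<^esub> b"
    using connected_G a b S by (auto simp: connected_def strongly_connected_def)
  then have "(a, b) \<in> (arcs_ends (mk_symmetric G))\<^sup>*"
    by (rule reachable_rtranclI)
  then have "b \<in> S"
  proof (induction rule: rtrancl_induct)
    case (step x y)
    then have "(x, y) \<in> parcs (mk_symmetric G)" by simp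
    then obtain e where "e \<in> arcs G" "(x, y) = (tail G e, head G e) \<or> (x, y) = (head G e, tail G e)"
      by (auto simp: parcs_mk_symmetric)
    then show ?case using eq[of e] step.IH by (auto simp: I_def split: if_splits)
  qed (use a in simp)
  then show False using b by simp
qed

lemma reachable_from:
  assumes "z \<in> verts G" "i \<in> verts G"
  shows "(z, i) \<in> (arcs_ends G)\<^sup>*"
proof -
  let ?S = "{j \<in> verts G. (z, j) \<in> (arcs_ends G)\<^sup>*}"
  have "?S = verts G"
  proof (rule ccontr)
    assume "?S \<noteq> verts G"
    moreover have "z \<in> ?S" using assms by simp
    ultimately obtain e where e: "e \<in> arcs G" "tail G e \<in> ?S" "head G e \<notin> ?S"
      using exists_arc_leaving[of ?S] by blast
    have "(tail G e, head G e) \<in> arcs_ends G" using e by (auto simp: arcs_ends_conv)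
    then show False using e by (auto intro: rtrancl_into_rtrancl)
  qed
  then show ?thesis using assms by auto
qed

text \<open>
  Every sandpile is stabilized off the sink by firing a large multiple of \<open>h\<close>, and \<open>h\<close> serves as a barrier
  in the bound for all such stabilizing functions. It is a steep concave function of the
  directed distance \<open>r\<close> from \<open>z\<close>: the loss along one arc from a closer vertex outweighs the possible gains along
  all other arcs.
\<close>

lemma exists_strict_superharmonic:
  assumes z: "z \<in> verts G"
  obtains h :: "'v \<Rightarrow> int" where "h z = 0" "\<And>i. i \<in> verts G \<Longrightarrow> 0 \<le> h i"
    "\<And>i. i \<in> verts G - {z} \<Longrightarrow> lap G h i \<le> -1"
proof -
  define r where "r i = (LEAST n. (z, i) \<in> arcs_ends G ^^ n)" for i
  have r: "(z, i) \<in> arcs_ends G ^^ r i" if "i \<in> verts G" for i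
    unfolding r_def using reachable_from[OF z that] by (metis LeastI_ex rtrancl_imp_relpow)
  have rz: "r z = 0" unfolding r_def by (rule Least_eq_0) simp
  have pred: "\<exists>e\<in>in_arcs G i. r (tail G e) < r i" if i: "i \<in> verts G - {z}" for i
  proof -
    have ri: "(z, i) \<in> arcs_ends G ^^ r i" using r i by simp
    then have "r i \<noteq> 0" using i by (cases "r i") auto
    then obtain n where n: "r i = Suc n" by (cases "r i") auto
    then obtain j where j: "(z, j) \<in> arcs_ends G ^^ n" "(j, i) \<in> arcs_ends G"
      using ri by auto
    have "r j \<le> n" unfolding r_def using j(1) by (rule Least_le)
    moreover obtain e where "e \<in> arcs G" "tail G e = j" "head G e = i"
      using j(2) by (auto simp: arcs_ends_conv)
    ultimately show ?thesis using n by (intro bexI[of _ e]) auto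
  qed
  define D where "D = Max (r ` verts G)"
  have rD: "r i \<le> D" if "i \<in> verts G" for i using that by (simp add: D_def)
  \<comment> \<open>The base exceeds every degree, so that one factor \<open>B\<close> outweighs the other in-arcs.\<close>
  define B where "B = Max (deg G ` verts G) + 1"
  have degB: "deg G i \<le> B - 1" if "i \<in> verts G" for i using that by (simp add: B_def)
  have B1: "1 \<le> B" using degB[OF z] by (simp add: deg_def)
  define h where "h i = B ^ D - B ^ (D - r i)" for i
  show thesis
  proof (rule that[of h])
    show "h z = 0" by (simp add: h_def rz)
    show "0 \<le> h i" if "i \<in> verts G" for i
      using B1 by (simp add: h_def power_increasing)
    show "lap G h i \<le> -1" if i: "i \<in> verts G - {z}" for i
    proof -
      define P where "P = B ^ (D - r i)"
      have P1: "1 \<le> P" using B1 by (simp add: P_def)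
      obtain e0 where e0: "e0 \<in> in_arcs G i" "r (tail G e0) < r i" using pred[OF i] by blast
      have "r (tail G e0) < r i \<and> r i \<le> D" using e0 rD i by auto
      then have "Suc (D - r i) \<le> D - r (tail G e0)" by linarith
      then have "B ^ Suc (D - r i) \<le> B ^ (D - r (tail G e0))" by (rule power_increasing) (use B1 in simp)
      then have t0: "h (tail G e0) - h i \<le> P - B * P" by (simp add: h_def P_def)
      have te: "h (tail G e) - h i \<le> P" for e using B1 by (simp add: h_def P_def)
      have deg_i: "int (card (in_arcs G i - {e0})) = deg G i - 1"
        using card_Suc_Diff1[OF finite_in_arcs e0(1)] i by (simp add: deg_eq_card_in_arcs)
      have "lap G h i = (h (tail G e0) - h i) + (\<Sum>e\<in>in_arcs G i - {e0}. h (tail G e) - h i)"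
        using i e0 by (simp add: lap_eq_sum_diff sum.remove)
      also have "\<dots> \<le> (P - B * P) + (\<Sum>e\<in>in_arcs G i - {e0}. P)"
        by (intro add_mono t0 sum_mono te)
      also have "\<dots> = (deg G i - B) * P"
        by (simp add: deg_i algebra_simps)
      also have "\<dots> \<le> (-1) * P" using degB[of i] i P1 by (intro mult_right_mono) auto
      finally show ?thesis using P1 by simp
    qed
  qed
qed

section \<open>Toppling and the least action principle\<close>

text \<open>
  The abelian property: the outcome depends only on how often each vertex topples.
\<close>

lemma fold_topple:
  "fold (topple G Z) is s j =
     (if j \<in> Z then s j else s j + lap G (\<lambda>k. int (count_list is k)) j)"
proof (induction "is" arbitrary: s)
  case Nil
  then show ?case by (simp add: lap_const)
next
  case (Cons i "is")
  have "lap G (\<lambda>k. int (count_list (i # is) k)) = lap G (\<lambda>k. chip i k + int (count_list is k))"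
    by (rule lap_cong) (simp add: chip_def)
  moreover have "fold (topple G Z) (i # is) s j =
      (if j \<in> Z then topple G Z i s j else topple G Z i s j + lap G (\<lambda>k. int (count_list is k)) j)"
    by (simp add: Cons.IH)
  moreover have "topple G Z i s j = (if j \<in> Z then s j else s j + lap G (chip i) j)"
    by (simp add: topple_def)
  ultimately show ?case by (simp only: lap_add) simp
qed

lemma legal_append:
  "legal G Z s (xs @ ys) \<longleftrightarrow> legal G Z s xs \<and> legal G Z (fold (topple G Z) xs s) ys"
  by (induction xs arbitrary: s) auto

lemma legal_subset: "legal G Z s is \<Longrightarrow> set is \<subseteq> verts G - Z"
  by (induction "is" arbitrary: s) auto

text \<open>
  A vertex that has already toppled \<open>w\<close> times, while no other vertex has toppled more often than \<open>w\<close>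
  allows, carries no more chips than under \<open>s + \<Delta>w\<close>. It is therefore stable and cannot topple again.
\<close>

lemma least_action:
  assumes "legal G Z s is" and w: "\<And>i. i \<in> verts G \<Longrightarrow> 0 \<le> w i"
    and stab: "\<And>i. i \<in> verts G - Z \<Longrightarrow> s i + lap G w i \<le> deg G i - 1"
    and "k \<in> verts G"
  shows "int (count_list is k) \<le> w k"
  using assms(1,4)
proof (induction "is" arbitrary: k rule: rev_induct)
  case Nil
  then show ?case using w by simp
next
  case (snoc i xs)
  have l: "legal G Z s xs" and i: "i \<in> verts G - Z"
    and unstable: "deg G i \<le> s i + lap G (\<lambda>k. int (count_list xs k)) i"
    using snoc.prems(1) by (auto simp: legal_append fold_topple)
  have le: "\<And>k. k \<in> verts G \<Longrightarrow> int (count_list xs k) \<le> w k"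
    using snoc.IH[OF l] .
  have "int (count_list xs i) \<noteq> w i"
  proof
    assume "int (count_list xs i) = w i"
    with le have "lap G (\<lambda>k. int (count_list xs k)) i \<le> lap G w i"
      by (intro lap_mono_at) auto
    with unstable stab[OF i] show False by simp
  qed
  then show ?case using le[OF snoc.prems(2)] le[of i] i by auto
qed

text \<open>
  By the least action principle, legal sequences have bounded length, and a longest one ends in a stable
  sandpile.
\<close>

lemma exists_stabilizing:
  assumes w: "\<And>i. i \<in> verts G \<Longrightarrow> 0 \<le> w i"
    and stab: "\<And>i. i \<in> verts G - Z \<Longrightarrow> s i + lap G w i \<le> deg G i - 1"
  shows "\<exists>is. stabilizing G Z s is"
proof -
  have bound: "length is \<le> nat (\<Sum>k\<in>verts G. w k)" if l: "legal G Z s is" for "is"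
  proof -
    have "int (length is) = (\<Sum>k\<in>verts G. int (count_list is k))"
      using legal_subset[OF l] by (subst sum_count_set[symmetric, of "is" "verts G"]) auto
    also have "\<dots> \<le> (\<Sum>k\<in>verts G. w k)"
      using least_action[OF l w stab] by (intro sum_mono) auto
    finally show ?thesis by linarith
  qed
  have "\<exists>is. legal G Z s is \<and> (\<forall>js. legal G Z s js \<longrightarrow> length js \<le> length is)"
    using bound by (intro ex_has_greatest_nat[of _ "[]" _ "Suc (nat (\<Sum>k\<in>verts G. w k))"])
      (simp_all add: less_Suc_eq_le)
  then obtain "is" where l: "legal G Z s is"
    and longest: "\<And>js. legal G Z s js \<Longrightarrow> length js \<le> length is" by blast
  have "stable G Z (fold (topple G Z) is s)"
    unfolding stable_def
  proof (rule ballI, rule ccontr)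
    fix i assume "i \<in> verts G - Z" "\<not> fold (topple G Z) is s i \<le> deg G i - 1"
    with l have "legal G Z s (is @ [i])" by (simp add: legal_append)
    from longest[OF this] show False by simp
  qed
  with l show ?thesis by (auto simp: stabilizing_def)
qed

text \<open>
  Two stabilizing sequences bound each other's toppling counts by the least action principle.
\<close>

lemma stabilization_eq:
  assumes "stabilizing G Z s is"
  shows "stabilization G Z s = fold (topple G Z) is s"
proof -
  have "fold (topple G Z) js s = fold (topple G Z) is s" if js: "stabilizing G Z s js" for js
  proof -
    have le: "int (count_list xs k) \<le> int (count_list ys k)"
      if "stabilizing G Z s xs" "stabilizing G Z s ys" "k \<in> verts G" for xs ys k
      using that by (intro least_action[of Z s]) (auto simp: stabilizing_def stable_def fold_topple)
    have "lap G (\<lambda>k. int (count_list js k)) = lap G (\<lambda>k. int (count_list is k))"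
      using le[OF js assms] le[OF assms js] by (intro lap_cong) (simp add: order_antisym)
    then show ?thesis by (intro ext) (simp add: fold_topple)
  qed
  then show ?thesis unfolding stabilization_def using assms by (intro the_equality) blast+
qed

text \<open>
  Constants lie in the kernel of the Laplacian, so a witness of either sign can be shifted to a nonnegative
  one. The right-hand side is invariant under adding Laplacians to \<open>s\<close>, and so is stabilizability.
\<close>

lemma stabilizable_iff:
  "stabilizable G s \<longleftrightarrow> (\<exists>w. \<forall>i\<in>verts G. s i + lap G w i \<le> deg G i - 1)"
proof
  assume "stabilizable G s"
  then show "\<exists>w. \<forall>i\<in>verts G. s i + lap G w i \<le> deg G i - 1"
    by (auto simp: stabilizable_def stabilizing_def stable_def fold_topple)
next
  assume "\<exists>w. \<forall>i\<in>verts G. s i + lap G w i \<le> deg G i - 1"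
  then obtain w where w: "\<And>i. i \<in> verts G \<Longrightarrow> s i + lap G w i \<le> deg G i - 1" by blast
  define c where "c = (\<Sum>k\<in>verts G. \<bar>w k\<bar>)"
  have "\<bar>w i\<bar> \<le> c" if "i \<in> verts G" for i
    unfolding c_def using that by (intro member_le_sum) auto
  then have "0 \<le> w i + c" if "i \<in> verts G" for i using that by force
  moreover have "s i + lap G (\<lambda>i. w i + c) i \<le> deg G i - 1" if "i \<in> verts G" for i
    using w[OF that] by (simp add: lap_add lap_const)
  ultimately show "stabilizable G s"
    unfolding stabilizable_def by (intro exists_stabilizing[of "\<lambda>i. w i + c"]) auto
qed

lemma stabilization_eq_add_lap:
  assumes "stabilizable G s"
  obtains u where "stabilization G {} s = (\<lambda>j. s j + lap G u j)"
proof -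
  obtain "is" where "stabilizing G {} s is" using assms by (auto simp: stabilizable_def)
  then have "stabilization G {} s = (\<lambda>j. s j + lap G (\<lambda>k. int (count_list is k)) j)"
    by (intro ext) (simp add: stabilization_eq fold_topple)
  then show thesis by (rule that)
qed

text \<open>
  Both branches of the closed chain stay in the same class modulo the image of the Laplacian; this is
  what makes the chain tractable also beyond the threshold.
\<close>

lemma add_chip_eq_add_lap:
  obtains u where "add_chip G i s = (\<lambda>j. s j + chip i j + lap G u j)"
proof (cases "stabilizable G (\<lambda>j. s j + chip i j)")
  case True
  then obtain u where "stabilization G {} (\<lambda>j. s j + chip i j) = (\<lambda>j. s j + chip i j + lap G u j)"
    by (rule stabilization_eq_add_lap)
  then show thesis using True by (intro that[of u]) (simp add: add_chip_def)
next
  case False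
  then show thesis by (intro that[of "\<lambda>_. 0"]) (simp add: add_chip_def lap_const)
qed

lemma lap_indicator:
  "i \<in> verts G \<Longrightarrow> lap G (\<lambda>j. if j \<in> T then 1 else 0) i = in_from G T i - (if i \<in> T then deg G i else 0)"
  by (simp add: lap_def in_from_eq_sum)

lemma in_from_Un:
  "S \<inter> T = {} \<Longrightarrow> in_from G (S \<union> T) i = in_from G S i + in_from G T i"
  unfolding in_from_eq_sum sum.distrib[symmetric] by (intro sum.cong) auto

lemma in_from_verts: "i \<in> verts G \<Longrightarrow> in_from G (verts G) i = deg G i"
  unfolding in_from_def deg_eq_card_in_arcs by (intro arg_cong[of _ _ int] arg_cong[of _ _ card]) (auto simp: in_arcs_def)

lemma in_from_Diff:
  assumes "i \<in> verts G" "S \<subseteq> verts G"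
  shows "in_from G (verts G - S) i = deg G i - in_from G S i"
  using in_from_Un[of S "verts G - S" i] assms by (simp add: in_from_verts Un_absorb1)

end

locale sandpile_sink = eulerian_digraph G for G :: "('v, 'e) pre_digraph" +
  fixes z :: 'v
  assumes z_in_verts: "z \<in> verts G"
begin

section \<open>Dhar's burning criterion\<close>

text \<open>
  A nonempty set of non-sink vertices all of which carry fewer chips than they have arcs from within the set is
  a forbidden subconfiguration: none of its vertices can be the first of the set to burn.
\<close>

definition no_forbidden :: "('v \<Rightarrow> int) \<Rightarrow> bool" where
  "no_forbidden s \<longleftrightarrow> (\<forall>S. S \<subseteq> verts G - {z} \<and> S \<noteq> {} \<longrightarrow> (\<exists>i\<in>S. in_from G S i \<le> s i))"

text \<open>
  The first vertex of \<open>S\<close> to topple has received at most one chip along each arc from outside \<open>S\<close>, and this made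
  it unstable.
\<close>

lemma no_forbidden_if_burning:
  assumes "legal G {z} (\<lambda>j. \<rho> j + lap G (chip z) j) is"
    and once: "\<And>i. i \<in> verts G - {z} \<Longrightarrow> count_list is i = 1"
  shows "no_forbidden \<rho>"
  unfolding no_forbidden_def
proof (intro allI impI)
  fix S assume S: "S \<subseteq> verts G - {z} \<and> S \<noteq> {}"
  then obtain i where "i \<in> S" "count_list is i = 1" using once by blast
  then have "i \<in> set is" using count_list_0_iff[of "is" i] by auto
  with \<open>i \<in> S\<close> have "\<exists>i\<in>set is. i \<in> S" by blast
  then obtain xs i ys where xs: "is = xs @ i # ys" "i \<in> S" "\<forall>j\<in>set xs. j \<notin> S"
    by (rule split_list_first_propE)
  have i: "i \<in> verts G" "i \<noteq> z" using S xs by auto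
  have cnt: "count_list xs j \<le> 1" if "j \<in> verts G - {z}" for j
    using once[OF that] xs(1) by simp
  have "z \<notin> set xs" "set xs \<subseteq> verts G"
    using assms(1) legal_subset[of "{z}"] xs(1) by (auto simp: legal_append)
  have "deg G i \<le> \<rho> i + lap G (\<lambda>j. chip z j + int (count_list xs j)) i"
    using assms(1) i by (simp add: xs(1) legal_append fold_topple lap_add)
  also have "\<dots> \<le> \<rho> i + lap G (\<lambda>j. if j \<in> verts G - S then 1 else 0) i"
  proof (intro add_left_mono lap_mono_at)
    have zero: "count_list xs j = 0" if "j \<in> insert z S" for j
      using that xs(3) \<open>z \<notin> set xs\<close> by (auto simp: count_list_0_iff)
    show "chip z j + int (count_list xs j) \<le> (if j \<in> verts G - S then 1 else 0)"
      if "j \<in> verts G" for j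
      using zero[of j] cnt[of j] S that by (cases "j = z"; cases "j \<in> S") (auto simp: chip_def)
    show "chip z i + int (count_list xs i) = (if i \<in> verts G - S then 1 else 0)"
      using zero[of i] xs(2) i by (simp add: chip_def)
  qed
  also have "\<dots> = \<rho> i + deg G i - in_from G S i"
    using i(1) xs(2) in_from_Diff[of i S] S by (subst lap_indicator) auto
  finally show "\<exists>i\<in>S. in_from G S i \<le> \<rho> i" using xs(2) by force
qed

text \<open>
  As long as the set of vertices that have not toppled is nonempty, it is not forbidden, and so contains a vertex
  that can topple next.
\<close>

lemma burning_if_no_forbidden:
  assumes "no_forbidden \<rho>" "n \<le> card (verts G - {z})"
  shows "\<exists>is. distinct is \<and> length is = n \<and> legal G {z} (\<lambda>j. \<rho> j + lap G (chip z) j) is"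
  using assms(2)
proof (induction n)
  case 0
  then show ?case by simp
next
  case (Suc n)
  then obtain "is" where xs: "distinct is" "length is = n" "legal G {z} (\<lambda>j. \<rho> j + lap G (chip z) j) is"
    by auto
  have sub: "set is \<subseteq> verts G - {z}" using legal_subset xs(3) by blast
  define S where "S = verts G - {z} - set is"
  have "card (set is) < card (verts G - {z})" using xs(1,2) Suc.prems by (simp add: distinct_card)
  then have "\<not> verts G - {z} \<subseteq> set is" using card_mono[OF finite_set, of "verts G - {z}" "is"] by linarith
  then have "S \<noteq> {}" unfolding S_def by blast
  moreover have "S \<subseteq> verts G - {z}" by (simp add: S_def Diff_subset)
  ultimately have "\<exists>i\<in>S. in_from G S i \<le> \<rho> i" using assms(1) by (simp add: no_forbidden_def)
  then obtain i where i: "i \<in> S" "in_from G S i \<le> \<rho> i" ..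
  then have iV: "i \<in> verts G" "i \<noteq> z" "i \<notin> set is" by (auto simp: S_def)
  have "\<rho> i + lap G (\<lambda>j. chip z j + int (count_list is j)) i
      = \<rho> i + lap G (\<lambda>j. if j \<in> verts G - S then 1 else 0) i"
  proof -
    have "lap G (\<lambda>j. chip z j + int (count_list is j)) = lap G (\<lambda>j. if j \<in> verts G - S then 1 else 0)"
      using sub xs(1) by (intro lap_cong) (auto simp: S_def chip_def count_list_distinct)
    then show ?thesis by simp
  qed
  also have "\<dots> = \<rho> i + deg G i - in_from G S i"
    using i(1) iV in_from_Diff[of i S] by (subst lap_indicator) (auto simp: S_def)
  finally have "legal G {z} (\<lambda>j. \<rho> j + lap G (chip z) j) (is @ [i])"
    using xs(3) iV i(2) by (simp add: legal_append fold_topple lap_add)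
  then show ?case using xs iV by (intro exI[of _ "is @ [i]"]) simp
qed

text \<open>
  Once every vertex including \<open>z\<close> has toppled, the Laplacian of the constant \<open>1\<close> has been added, so the burning
  process ends at the stable sandpile where it began.
\<close>

lemma Rec_iff:
  "\<rho> \<in> Rec G z \<longleftrightarrow> \<rho> \<in> vfuns G \<and> \<rho> z = deg G z \<and> (\<forall>i\<in>verts G - {z}. \<rho> i \<le> deg G i - 1) \<and> no_forbidden \<rho>"
proof
  assume "\<rho> \<in> Rec G z"
  then show "\<rho> \<in> vfuns G \<and> \<rho> z = deg G z \<and> (\<forall>i\<in>verts G - {z}. \<rho> i \<le> deg G i - 1) \<and> no_forbidden \<rho>"
    unfolding Rec_def stabilizing_def using no_forbidden_if_burning by blast
next
  assume \<rho>: "\<rho> \<in> vfuns G \<and> \<rho> z = deg G z \<and> (\<forall>i\<in>verts G - {z}. \<rho> i \<le> deg G i - 1) \<and> no_forbidden \<rho>"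
  then obtain "is" where xs: "distinct is" "length is = card (verts G - {z})"
    "legal G {z} (\<lambda>j. \<rho> j + lap G (chip z) j) is"
    using burning_if_no_forbidden by blast
  have set: "set is = verts G - {z}"
    using xs legal_subset[OF xs(3)] by (intro card_subset_eq) (auto simp: distinct_card)
  have once: "count_list is i = 1" if "i \<in> verts G - {z}" for i
    using that xs(1) set by (simp add: count_list_distinct)
  have "lap G (\<lambda>j. chip z j + int (count_list is j)) = lap G (\<lambda>_. 1)"
    using once set by (intro lap_cong) (auto simp: chip_def count_list_0_iff)
  then have "lap G (chip z) j + lap G (\<lambda>j. int (count_list is j)) j = 0" for j
    by (simp add: lap_const flip: lap_add)
  then have "stable G {z} (fold (topple G {z}) is (\<lambda>j. \<rho> j + lap G (chip z) j))"
    using \<rho> by (simp add: stable_def fold_topple add.assoc)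
  with xs(3) have "stabilizing G {z} (\<lambda>j. \<rho> j + lap G (chip z) j) is"
    by (simp add: stabilizing_def)
  then have "\<exists>is. stabilizing G {z} (\<lambda>j. \<rho> j + lap G (chip z) j) is \<and>
      (\<forall>i\<in>verts G - {z}. count_list is i = 1)"
    using once by blast
  then show "\<rho> \<in> Rec G z" using \<rho> by (simp add: Rec_def)
qed

text \<open>
  The normalization \<open>\<rho> z = deg z\<close> lets \<open>z\<close> play the part of an escaping vertex, so that sets
  containing the sink need no separate treatment below.
\<close>

lemma Rec_escape:
  assumes \<rho>: "\<rho> \<in> Rec G z" and S: "S \<subseteq> verts G" "S \<noteq> {}"
  shows "\<exists>i\<in>S. in_from G S i \<le> \<rho> i"
proof (cases "z \<in> S")
  case True
  moreover have "in_from G S z \<le> \<rho> z" using \<rho> in_from_le_deg[of z S] z_in_verts by (simp add: Rec_iff)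
  ultimately show ?thesis by blast
next
  case False
  then have "S \<subseteq> verts G - {z}" using S(1) by blast
  then show ?thesis using \<rho> S(2) by (simp add: Rec_iff no_forbidden_def)
qed

lemma argmin_nonempty:
  fixes w :: "'v \<Rightarrow> int"
  shows "\<exists>j\<in>verts G. \<forall>k\<in>verts G. w j \<le> w k"
  using z_in_verts ex_is_arg_min_if_finite[of "verts G" w] by (auto simp: is_arg_min_linorder)

text \<open>
  The vertex that escapes from the set of minimizers of \<open>w\<close> gains from \<open>\<Delta>w\<close> at least one chip for each
  arc from outside this set, which makes it unstable.
\<close>

lemma Rec_lap_unstable_at_argmin:
  assumes \<rho>: "\<rho> \<in> Rec G z"
  shows "\<exists>i\<in>verts G. (\<forall>k\<in>verts G. w i \<le> w k) \<and> deg G i \<le> \<rho> i + lap G w i"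
proof -
  define S where "S = {j \<in> verts G. \<forall>k\<in>verts G. w j \<le> w k}"
  have "S \<subseteq> verts G" "S \<noteq> {}" using argmin_nonempty[of w] by (auto simp: S_def)
  then obtain i where i: "i \<in> S" "in_from G S i \<le> \<rho> i" using Rec_escape[OF \<rho>] by blast
  then have "i \<in> verts G" by (simp add: S_def)
  then have "deg G i \<le> \<rho> i + lap G w i" using lap_at_argmin[OF i(1) _ S_def] i(2) by simp
  then show ?thesis using i(1) unfolding S_def by blast
qed

text \<open>
  Away from the sink \<open>\<rho>'\<close> is stable, so the unstable minimizer of \<open>w\<close> can only be the sink, where \<open>w\<close>
  vanishes. Exchanging \<open>\<rho>\<close> and \<open>\<rho>'\<close> gives the opposite inequality.
\<close>

lemma Rec_unique_mod_lap:
  assumes "\<rho> \<in> Rec G z" "\<rho>' \<in> Rec G z" and w: "w z = 0"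
    and eq: "\<And>i. i \<in> verts G - {z} \<Longrightarrow> \<rho>' i = \<rho> i + lap G w i"
    and j: "j \<in> verts G"
  shows "w j = 0"
proof -
  have nonneg: "0 \<le> w j"
    if *: "\<rho> \<in> Rec G z" "\<rho>' \<in> Rec G z" "w z = 0" "\<And>i. i \<in> verts G - {z} \<Longrightarrow> \<rho>' i = \<rho> i + lap G w i"
    for \<rho> \<rho>' w
  proof -
    obtain i where i: "i \<in> verts G" "\<forall>k\<in>verts G. w i \<le> w k" "deg G i \<le> \<rho> i + lap G w i"
      using Rec_lap_unstable_at_argmin[OF *(1)] by blast
    have "i = z"
    proof (rule ccontr)
      assume "i \<noteq> z"
      then have "\<rho>' i \<le> deg G i - 1" "\<rho>' i = \<rho> i + lap G w i"
        using i(1) *(2,4) by (auto simp: Rec_iff)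
      then show False using i(3) by simp
    qed
    then show ?thesis using i(2) j *(3) by auto
  qed
  have "0 \<le> - w j"
    using assms by (intro nonneg[of \<rho>' \<rho> "\<lambda>i. - w i"]) (auto simp: lap_uminus)
  with nonneg[OF assms(1-4)] show ?thesis by simp
qed

section \<open>The recurrent decomposition\<close>

text \<open>
  The recurrent decomposition without the normalization of \<open>v\<close>, which only affects \<open>v\<close> by a
  constant. In this form the relation is plainly compatible with adding Laplacians.
\<close>

definition rec_rep :: "('v \<Rightarrow> int) \<Rightarrow> ('v \<Rightarrow> int) \<Rightarrow> int \<Rightarrow> bool" where
  "rec_rep s \<rho> m \<longleftrightarrow> \<rho> \<in> Rec G z \<and> (\<exists>v. s = (\<lambda>j. \<rho> j + m * chip z j + lap G v j))"

lemma rec_rep_normalized: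
  assumes "rec_rep s \<rho> m"
  obtains v where "v \<in> vfuns G" "v z = 0" "s = (\<lambda>j. \<rho> j + m * chip z j + lap G v j)"
proof -
  obtain v where v: "s = (\<lambda>j. \<rho> j + m * chip z j + lap G v j)"
    using assms by (auto simp: rec_rep_def)
  define v' where "v' = restrict (\<lambda>j. v j - v z) (verts G)"
  have "lap G v' = lap G (\<lambda>j. v j - v z)" by (rule lap_cong) (simp add: v'_def)
  then have "lap G v' = lap G v" by (intro ext) (simp add: lap_diff lap_const)
  with v z_in_verts show thesis by (intro that[of v']) (auto simp: v'_def vfuns_def)
qed

lemma recurrent_decomposition_unique:
  assumes "\<rho> \<in> Rec G z" "\<rho>' \<in> Rec G z" "v \<in> vfuns G" "v' \<in> vfuns G" "v z = 0" "v' z = 0"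
    and eq: "(\<lambda>j. \<rho> j + m * chip z j + lap G v j) = (\<lambda>j. \<rho>' j + m' * chip z j + lap G v' j)"
  shows "\<rho> = \<rho>' \<and> m = m' \<and> v = v'"
proof -
  have eq': "\<rho> j + m * chip z j + lap G v j = \<rho>' j + m' * chip z j + lap G v' j" for j
    using eq by metis
  have w: "v j - v' j = 0" if "j \<in> verts G" for j
  proof (rule Rec_unique_mod_lap[OF assms(1,2) _ _ that, where w = "\<lambda>j. v j - v' j"])
    show "\<rho>' i = \<rho> i + lap G (\<lambda>j. v j - v' j) i" if "i \<in> verts G - {z}" for i
      using eq'[of i] that by (simp add: chip_def lap_diff)
  qed (use assms in simp)
  then have v: "v = v'" using assms(3,4) unfolding vfuns_def by (intro PiE_ext) auto
  then have e: "\<rho> j + m * chip z j = \<rho>' j + m' * chip z j" for j using eq'[of j] by simp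
  have m: "m = m'" using e[of z] assms(1,2) by (simp add: Rec_iff chip_def)
  with e v show ?thesis by auto
qed

lemma rec_rep_unique:
  assumes "rec_rep s \<rho> m" "rec_rep s \<rho>' m'"
  shows "\<rho> = \<rho>'" "m = m'"
proof -
  obtain v where "v \<in> vfuns G" "v z = 0" "s = (\<lambda>j. \<rho> j + m * chip z j + lap G v j)"
    using rec_rep_normalized[OF assms(1)] .
  moreover obtain v' where "v' \<in> vfuns G" "v' z = 0" "s = (\<lambda>j. \<rho>' j + m' * chip z j + lap G v' j)"
    using rec_rep_normalized[OF assms(2)] .
  ultimately have "\<rho> = \<rho>' \<and> m = m' \<and> v = v'"
    using assms by (intro recurrent_decomposition_unique) (auto simp: rec_rep_def)
  then show "\<rho> = \<rho>'" "m = m'" by simp_all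
qed

lemma rec_decomp_of_rep:
  assumes "rec_rep s \<rho> m"
  shows "rec_part G z s = \<rho>" "sink_part G z s = m"
proof -
  obtain v where v: "v \<in> vfuns G" "v z = 0" "s = (\<lambda>j. \<rho> j + m * chip z j + lap G v j)"
    using rec_rep_normalized[OF assms] .
  have \<rho>: "\<rho> \<in> Rec G z" using assms by (simp add: rec_rep_def)
  have "rec_decomp G z s = (\<rho>, m, v)"
    unfolding rec_decomp_def
  proof (rule the_equality)
    fix p assume p: "case p of (\<rho>, m, v) \<Rightarrow> \<rho> \<in> Rec G z \<and> v \<in> vfuns G \<and> v z = 0 \<and>
        s = (\<lambda>j. \<rho> j + m * chip z j + lap G v j)"
    obtain \<rho>' m' v' where p': "p = (\<rho>', m', v')" by (cases p)
    with p have *: "\<rho>' \<in> Rec G z" "v' \<in> vfuns G" "v' z = 0" "s = (\<lambda>j. \<rho>' j + m' * chip z j + lap G v' j)"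
      by auto
    have "\<rho>' = \<rho> \<and> m' = m \<and> v' = v"
      using *(4) v(3) by (intro recurrent_decomposition_unique * \<rho> v(1,2)) simp
    then show "p = (\<rho>, m, v)" using p' by simp
  qed (use v \<rho> in auto)
  then show "rec_part G z s = \<rho>" "sink_part G z s = m"
    by (simp_all add: rec_part_def sink_part_def)
qed

lemma rec_rep_add_lap:
  assumes "rec_rep s \<rho> m"
  shows "rec_rep (\<lambda>j. s j + lap G u j) \<rho> m"
proof -
  obtain v where v: "s = (\<lambda>j. \<rho> j + m * chip z j + lap G v j)" and \<rho>: "\<rho> \<in> Rec G z"
    using assms by (auto simp: rec_rep_def)
  have "(\<lambda>j. s j + lap G u j) = (\<lambda>j. \<rho> j + m * chip z j + lap G (\<lambda>j. v j + u j) j)"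
    by (rule ext) (simp add: v lap_add)
  with \<rho> show ?thesis unfolding rec_rep_def by blast
qed

lemma rec_rep_chip_count: "rec_rep s \<rho> m \<Longrightarrow> chip_count G s = chip_count G \<rho> + m"
  using z_in_verts
  by (auto simp: rec_rep_def chip_count_add chip_count_chip chip_count_lap)

lemma rec_rep_in_vfuns: "rec_rep s \<rho> m \<Longrightarrow> s \<in> vfuns G"
  using z_in_verts
  by (auto simp: rec_rep_def Rec_iff vfuns_def PiE_iff extensional_def chip_def lap_outside)

text \<open>
  For \<open>m < 0\<close> the sandpile \<open>\<rho> + m \<delta>\<^sub>z\<close> is itself stable. For \<open>m \<ge> 0\<close> it dominates the recurrent \<open>\<rho>\<close>, and no
  Laplacian makes \<open>\<rho>\<close> stable, because a minimizer of the added function becomes or remains unstable.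
\<close>

lemma stabilizable_iff_rep:
  assumes "rec_rep s \<rho> m"
  shows "stabilizable G s \<longleftrightarrow> m < 0"
proof -
  obtain v where v: "s = (\<lambda>j. \<rho> j + m * chip z j + lap G v j)" and \<rho>: "\<rho> \<in> Rec G z"
    using assms by (auto simp: rec_rep_def)
  show ?thesis
  proof
    assume "m < 0"
    then have "\<forall>i\<in>verts G. s i + lap G (\<lambda>j. - v j) i \<le> deg G i - 1"
      using \<rho> by (auto simp: v lap_uminus Rec_iff chip_def)
    then show "stabilizable G s" using stabilizable_iff by blast
  next
    assume "stabilizable G s"
    then obtain w where w: "\<forall>i\<in>verts G. s i + lap G w i \<le> deg G i - 1"
      using stabilizable_iff by blast
    obtain i where i: "i \<in> verts G" "deg G i \<le> \<rho> i + lap G (\<lambda>j. v j + w j) i"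
      using Rec_lap_unstable_at_argmin[OF \<rho>] by blast
    have "deg G i + m * chip z i \<le> s i + lap G w i"
      using i by (simp add: v lap_add)
    also have "\<dots> \<le> deg G i - 1" using w i by blast
    finally show "m < 0" by (simp add: chip_def split: if_splits)
  qed
qed

lemma exists_sink_stabilizer:
  "\<exists>w. w z = 0 \<and> (\<forall>i\<in>verts G. 0 \<le> w i) \<and> (\<forall>i\<in>verts G - {z}. s i + lap G w i \<le> deg G i - 1)"
proof -
  obtain h where h: "h z = 0" "\<And>i. i \<in> verts G \<Longrightarrow> 0 \<le> h i"
    "\<And>i. i \<in> verts G - {z} \<Longrightarrow> lap G h i \<le> -1"
    using exists_strict_superharmonic[OF z_in_verts] by blast
  define N where "N = (\<Sum>k\<in>verts G. \<bar>s k - (deg G k - 1)\<bar>)"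
  have N: "s i - (deg G i - 1) \<le> N" if "i \<in> verts G" for i
  proof -
    have "\<bar>s i - (deg G i - 1)\<bar> \<le> N" unfolding N_def using that by (intro member_le_sum) auto
    then show ?thesis by simp
  qed
  have "0 \<le> N" unfolding N_def by (intro sum_nonneg) auto
  show ?thesis
  proof (intro exI[of _ "\<lambda>i. N * h i"] conjI ballI)
    show "s i + lap G (\<lambda>i. N * h i) i \<le> deg G i - 1" if "i \<in> verts G - {z}" for i
      using mult_left_mono[OF h(3)[OF that] \<open>0 \<le> N\<close>] N[of i] that by (simp add: lap_scale)
  qed (use h \<open>0 \<le> N\<close> in auto)
qed

text \<open>
  Adding a function \<open>w\<close> with very negative Laplacian makes \<open>v + w\<close> strictly superharmonic off the sink, so its
  minimum is attained at the sink.
\<close>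

lemma sink_stabilizers_bounded_below:
  "\<exists>b. \<forall>v. v z = 0 \<and> (\<forall>i\<in>verts G - {z}. s i + lap G v i \<le> deg G i - 1) \<longrightarrow>
    (\<forall>i\<in>verts G. - b i \<le> v i)"
proof -
  \<comment> \<open>The sandpile to be stabilized is chosen so that \<open>\<Delta>w\<close> outweighs the upper bound on \<open>\<Delta>v\<close>.\<close>
  obtain w where w: "w z = 0"
    "\<forall>i\<in>verts G - {z}. (deg G i - s i + deg G i) + lap G w i \<le> deg G i - 1"
    using exists_sink_stabilizer[of "\<lambda>i. deg G i - s i + deg G i"] by blast
  show ?thesis
  proof (intro exI[of _ w] allI impI ballI)
    fix v i assume v: "v z = 0 \<and> (\<forall>i\<in>verts G - {z}. s i + lap G v i \<le> deg G i - 1)"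
      and i: "i \<in> verts G"
    obtain j where j: "j \<in> verts G" "\<forall>k\<in>verts G. v j + w j \<le> v k + w k"
      using argmin_nonempty[of "\<lambda>k. v k + w k"] by blast
    have "0 \<le> (\<Sum>e\<in>in_arcs G j. (v (tail G e) + w (tail G e)) - (v j + w j))"
      using j(2) by (intro sum_nonneg) (auto simp: in_arcs_def)
    then have "0 \<le> lap G (\<lambda>k. v k + w k) j" using j(1) by (simp add: lap_eq_sum_diff)
    moreover have "lap G (\<lambda>k. v k + w k) j \<le> - 1" if "j \<noteq> z"
      using bspec[OF conjunct2[OF v], of j] bspec[OF w(2), of j] j(1) that by (simp add: lap_add)
    ultimately have "j = z" by fastforce
    then have "0 \<le> v i + w i" using j(2) i v w(1) by auto
    then show "- w i \<le> v i" by simp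
  qed
qed

text \<open>
  Among the functions \<open>v\<close> that vanish at \<open>z\<close> and make \<open>s + \<Delta>v\<close> stable off the sink, one with the smallest sum
  leads to a recurrent sandpile: a forbidden set could be untoppled once more without making any
  vertex unstable.
\<close>

lemma exists_rec_rep:
  assumes s: "s \<in> vfuns G"
  obtains \<rho> m where "rec_rep s \<rho> m"
proof -
  define stab where "stab v \<longleftrightarrow> v z = 0 \<and> (\<forall>i\<in>verts G - {z}. s i + lap G v i \<le> deg G i - 1)" for v
  obtain b where b: "\<And>v i. stab v \<Longrightarrow> i \<in> verts G \<Longrightarrow> - b i \<le> v i"
    using sink_stabilizers_bounded_below[of s] by (fold stab_def) blast
  define f where "f v = nat (\<Sum>i\<in>verts G. v i + b i)" for v
  have int_f: "int (f v) = (\<Sum>i\<in>verts G. v i + b i)" if "stab v" for v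
  proof -
    have "0 \<le> v i + b i" if "i \<in> verts G" for i using b[OF \<open>stab v\<close> that] by simp
    then have "0 \<le> (\<Sum>i\<in>verts G. v i + b i)" by (rule sum_nonneg)
    then show ?thesis by (simp add: f_def)
  qed
  have "\<exists>w. stab w" unfolding stab_def using exists_sink_stabilizer[of s] by blast
  then obtain w where "stab w" ..
  then have "\<exists>v. stab v \<and> (\<forall>u. stab u \<longrightarrow> f v \<le> f u)" using ex_has_least_nat[of stab w f] by blast
  then obtain v where v: "stab v" "\<And>u. stab u \<Longrightarrow> f v \<le> f u" by blast
  define \<rho> where "\<rho> = (\<lambda>j. s j + lap G v j)(z := deg G z)"
  have "no_forbidden \<rho>"
    unfolding no_forbidden_def
  proof (intro allI impI, rule ccontr)
    fix S assume S: "S \<subseteq> verts G - {z} \<and> S \<noteq> {}" and no: "\<not> (\<exists>i\<in>S. in_from G S i \<le> \<rho> i)"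
    define I where "I j = (if j \<in> S then 1 else 0 :: int)" for j
    have "stab (\<lambda>j. v j - I j)"
      unfolding stab_def
    proof (intro conjI ballI)
      show "v z - I z = 0" using v(1) S by (auto simp: stab_def I_def)
      fix i assume i: "i \<in> verts G - {z}"
      have lapI: "lap G I i = in_from G S i - (if i \<in> S then deg G i else 0)"
        using i lap_indicator[of i S] unfolding I_def by simp
      have "s i + lap G v i \<le> deg G i - 1" using v(1) i by (simp add: stab_def)
      moreover have "s i + lap G v i < in_from G S i" if "i \<in> S"
        using no that i by (auto simp: \<rho>_def not_le)
      ultimately show "s i + lap G (\<lambda>j. v j - I j) i \<le> deg G i - 1"
        using lapI in_from_nonneg[of S i] by (simp add: lap_diff split: if_splits)
    qed
    from int_f[OF this] v(2)[OF this]
    have "int (f v) \<le> (\<Sum>i\<in>verts G. (v i - I i) + b i)" by simp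
    moreover have "(\<Sum>i\<in>verts G. (v i - I i) + b i) = (\<Sum>i\<in>verts G. v i + b i) - (\<Sum>i\<in>verts G. I i)"
      by (simp add: sum.distrib sum_subtractf)
    moreover have "(\<Sum>i\<in>verts G. I i) = int (card S)"
    proof -
      have "(\<Sum>i\<in>verts G. I i) = (\<Sum>i\<in>verts G \<inter> S. 1)"
        unfolding I_def by (subst sum.inter_restrict) simp_all
      also have "verts G \<inter> S = S" using S by blast
      finally show ?thesis by simp
    qed
    moreover have "card S > 0"
      using S finite_subset[of S "verts G"] by (auto simp: card_gt_0_iff)
    ultimately show False using int_f[OF v(1)] by simp
  qed
  moreover have "\<rho> \<in> vfuns G"
    using s z_in_verts by (auto simp: \<rho>_def vfuns_def PiE_iff extensional_def lap_outside)
  ultimately have "\<rho> \<in> Rec G z" using v(1) by (auto simp: Rec_iff \<rho>_def stab_def)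
  moreover have "s = (\<lambda>j. \<rho> j + (s z + lap G v z - deg G z) * chip z j + lap G (\<lambda>j. - v j) j)"
    by (rule ext) (simp add: \<rho>_def chip_def lap_uminus)
  ultimately have "rec_rep s \<rho> (s z + lap G v z - deg G z)" unfolding rec_rep_def by blast
  then show thesis by (rule that)
qed

lemma Rec_nonneg:
  assumes \<rho>: "\<rho> \<in> Rec G z" and i: "i \<in> verts G"
  shows "0 \<le> \<rho> i"
  using Rec_escape[OF \<rho>, of "{i}"] i in_from_nonneg[of "{i}" i] by auto

lemma chip_count_Rec_nonneg: "\<rho> \<in> Rec G z \<Longrightarrow> 0 \<le> chip_count G \<rho>"
  unfolding chip_count_def by (intro sum_nonneg Rec_nonneg)

lemma finite_Rec: "finite (Rec G z)"
proof (rule finite_subset)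
  show "Rec G z \<subseteq> (\<Pi>\<^sub>E i\<in>verts G. {0..deg G i})"
  proof
    fix \<rho> assume \<rho>: "\<rho> \<in> Rec G z"
    have "\<rho> i \<le> deg G i" if "i \<in> verts G" for i
      using \<rho> that unfolding Rec_iff by (cases "i = z") force+
    then show "\<rho> \<in> (\<Pi>\<^sub>E i\<in>verts G. {0..deg G i})"
      using \<rho> Rec_nonneg[OF \<rho>] by (auto simp: Rec_iff vfuns_def PiE_iff)
  qed
qed (simp add: finite_PiE)

lemma Rec_nonempty: "Rec G z \<noteq> {}"
proof -
  have "restrict (\<lambda>_. 0) (verts G) \<in> vfuns G" by (simp add: vfuns_def)
  then obtain \<rho> m where "rec_rep (restrict (\<lambda>_. 0) (verts G)) \<rho> m" using exists_rec_rep by blast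
  then show ?thesis by (auto simp: rec_rep_def)
qed

section \<open>Open addition operators\<close>

lemma no_forbiddenD:
  "no_forbidden s \<Longrightarrow> S \<subseteq> verts G - {z} \<Longrightarrow> S \<noteq> {} \<Longrightarrow> \<exists>i\<in>S. in_from G S i \<le> s i"
  by (simp add: no_forbidden_def)

lemma no_forbidden_mono:
  assumes "no_forbidden s" "\<And>i. i \<in> verts G - {z} \<Longrightarrow> s i \<le> t i"
  shows "no_forbidden t"
  unfolding no_forbidden_def
proof (intro allI impI)
  fix S assume S: "S \<subseteq> verts G - {z} \<and> S \<noteq> {}"
  then obtain i where "i \<in> S" "in_from G S i \<le> s i" using assms(1) unfolding no_forbidden_def by blast
  moreover have "s i \<le> t i" using assms(2) S \<open>i \<in> S\<close> by blast
  ultimately show "\<exists>i\<in>S. in_from G S i \<le> t i" by force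
qed

text \<open>
  Only sets that contain the toppling vertex \<open>k\<close> lose chips. If \<open>k\<close> alone is the set, its loops return enough
  chips; otherwise the vertex that escapes from \<open>S - {k}\<close> also escapes from \<open>S\<close>, thanks to the chips that it
  receives from \<open>k\<close>.
\<close>

lemma no_forbidden_topple:
  assumes nf: "no_forbidden s" and k: "k \<in> verts G - {z}" "deg G k \<le> s k"
  shows "no_forbidden (topple G {z} k s)"
  unfolding no_forbidden_def
proof (intro allI impI)
  fix S assume S: "S \<subseteq> verts G - {z} \<and> S \<noteq> {}"
  have t: "topple G {z} k s i = s i + in_from G {k} i - (if i = k then deg G i else 0)"
    if "i \<in> S" for i
  proof -
    have i: "i \<in> verts G" "i \<noteq> z" using S that by auto
    have "lap G (chip k) = lap G (\<lambda>j. if j \<in> {k} then 1 else 0)"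
      by (intro lap_cong) (simp add: chip_def)
    then show ?thesis using i lap_indicator[of i "{k}"] by (simp add: topple_def)
  qed
  consider "S = {k}" | "S \<noteq> {k}" "S - {k} \<noteq> {}" using S by blast
  then show "\<exists>i\<in>S. in_from G S i \<le> topple G {z} k s i"
  proof cases
    case 1
    then show ?thesis using t[of k] k(2) by simp
  next
    case 2
    have "S - {k} \<subseteq> verts G - {z}" using S by blast
    then obtain i where i: "i \<in> S - {k}" "in_from G (S - {k}) i \<le> s i"
      using no_forbiddenD[OF nf _ 2(2)] by blast
    have "in_from G S i \<le> in_from G ((S - {k}) \<union> {k}) i" by (rule in_from_mono) blast
    also have "\<dots> = in_from G (S - {k}) i + in_from G {k} i" by (rule in_from_Un) blast
    finally show ?thesis using i t[of i] by (intro bexI[of _ i]) auto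
  qed
qed

lemma no_forbidden_legal:
  "legal G {z} s is \<Longrightarrow> no_forbidden s \<Longrightarrow> no_forbidden (fold (topple G {z}) is s)"
  by (induction "is" arbitrary: s) (auto simp: no_forbidden_topple)

text \<open>
  The number \<open>m\<close> counts the chips that reach the sink during stabilization, whence it is nonnegative.
\<close>

lemma rec_rep_open_add_self:
  assumes \<rho>: "\<rho> \<in> Rec G z" and i: "i \<in> verts G"
  obtains m where "0 \<le> m" "rec_rep (\<lambda>j. \<rho> j + chip i j) (open_add G z i \<rho>) m"
proof -
  define t where "t = (\<lambda>j. \<rho> j + chip i j)"
  have t_at: "t j = \<rho> j + chip i j" for j by (simp add: t_def)
  obtain w where w: "\<forall>i\<in>verts G. 0 \<le> w i"
    "\<forall>i\<in>verts G - {z}. t i + lap G w i \<le> deg G i - 1"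
    using exists_sink_stabilizer[of t] by blast
  have "\<exists>is. stabilizing G {z} t is" using w by (intro exists_stabilizing[of w]) auto
  then obtain "is" where xs: "stabilizing G {z} t is" ..
  define u where "u = (\<lambda>k. int (count_list is k))"
  have z_not: "z \<notin> set is" using xs legal_subset[of "{z}" t "is"] by (auto simp: stabilizing_def)
  have uz: "u z = 0" using z_not by (simp add: u_def count_list_0_iff)
  have fold_is: "fold (topple G {z}) is t j = (if j = z then t j else t j + lap G u j)" for j
    by (simp add: fold_topple u_def)
  have \<sigma>: "open_add G z i \<rho> = (fold (topple G {z}) is t)(z := deg G z)"
    using stabilization_eq[OF xs] unfolding open_add_def t_def by simp
  have "no_forbidden t"
    using \<rho> by (intro no_forbidden_mono[of \<rho> t]) (auto simp: Rec_iff t_def chip_def)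
  then have "no_forbidden (fold (topple G {z}) is t)"
    using xs by (intro no_forbidden_legal) (auto simp: stabilizing_def)
  then have "no_forbidden (open_add G z i \<rho>)"
    by (rule no_forbidden_mono) (simp add: \<sigma>)
  moreover have "open_add G z i \<rho> j = undefined" if "j \<notin> verts G" for j
  proof -
    have "j \<noteq> z" "j \<noteq> i" "\<rho> j = undefined"
      using that \<rho> i z_in_verts by (auto simp: Rec_iff vfuns_def PiE_iff extensional_def)
    then show ?thesis using that by (simp add: \<sigma> fold_is lap_outside t_at chip_def)
  qed
  then have "open_add G z i \<rho> \<in> vfuns G" by (simp add: vfuns_def PiE_iff extensional_def)
  moreover have "open_add G z i \<rho> j \<le> deg G j - 1" if "j \<in> verts G - {z}" for j
    using xs that by (simp add: \<sigma> stabilizing_def stable_def)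
  moreover have "open_add G z i \<rho> z = deg G z" by (simp add: \<sigma>)
  ultimately have Rec: "open_add G z i \<rho> \<in> Rec G z" by (simp add: Rec_iff)
  define m where "m = chip i z + lap G u z"
  have "lap G u z = (\<Sum>e\<in>in_arcs G z. u (tail G e))"
    using uz z_in_verts by (simp add: lap_def)
  also have "\<dots> \<ge> 0" by (intro sum_nonneg) (simp add: u_def)
  finally have "0 \<le> m" by (simp add: m_def chip_def)
  moreover have "t = (\<lambda>j. open_add G z i \<rho> j + m * chip z j + lap G (\<lambda>j. - u j) j)"
  proof
    fix j show "t j = open_add G z i \<rho> j + m * chip z j + lap G (\<lambda>j. - u j) j"
      using \<rho> by (cases "j = z") (auto simp: \<sigma> fold_is m_def t_at lap_uminus chip_def Rec_iff)
  qed
  ultimately show thesis using Rec by (intro that[of m]) (auto simp: rec_rep_def t_def)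
qed

lemma open_add_in_Rec: "\<rho> \<in> Rec G z \<Longrightarrow> i \<in> verts G \<Longrightarrow> open_add G z i \<rho> \<in> Rec G z"
  using rec_rep_open_add_self[of \<rho> i] by (auto simp: rec_rep_def)

text \<open>
  The open addition operators implement the addition of a chip modulo the Laplacian. The coefficient of
  \<open>z\<close> is dictated by conservation of chips, and it does not decrease.
\<close>

lemma rec_rep_open_add:
  assumes s: "rec_rep s \<rho> m" and i: "i \<in> verts G"
  shows "rec_rep (\<lambda>j. s j + chip i j) (open_add G z i \<rho>) (m + 1 + chip_count G \<rho> - chip_count G (open_add G z i \<rho>))"
    and "chip_count G (open_add G z i \<rho>) \<le> chip_count G \<rho> + 1"
proof -
  obtain v where v: "s = (\<lambda>j. \<rho> j + m * chip z j + lap G v j)" and \<rho>: "\<rho> \<in> Rec G z"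
    using s by (auto simp: rec_rep_def)
  obtain k where k: "0 \<le> k" "rec_rep (\<lambda>j. \<rho> j + chip i j) (open_add G z i \<rho>) k"
    using rec_rep_open_add_self[OF \<rho> i] .
  then obtain u where u: "\<And>j. \<rho> j + chip i j = open_add G z i \<rho> j + k * chip z j + lap G u j"
    by (auto simp: rec_rep_def fun_eq_iff)
  have "chip_count G (\<lambda>j. \<rho> j + chip i j) = chip_count G (open_add G z i \<rho>) + k"
    using rec_rep_chip_count[OF k(2)] .
  moreover have "chip_count G (\<lambda>j. \<rho> j + chip i j) = chip_count G \<rho> + 1"
    using chip_count_chip[OF i, of 1] by (simp add: chip_count_add)
  ultimately have k_eq: "k = 1 + chip_count G \<rho> - chip_count G (open_add G z i \<rho>)" by simp
  show "chip_count G (open_add G z i \<rho>) \<le> chip_count G \<rho> + 1" using k(1) k_eq by simp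
  have "s j + chip i j = open_add G z i \<rho> j + (m + k) * chip z j + lap G (\<lambda>j. v j + u j) j" for j
    using u[of j] by (simp add: v lap_add algebra_simps)
  then have "rec_rep (\<lambda>j. s j + chip i j) (open_add G z i \<rho>) (m + k)"
    using open_add_in_Rec[OF \<rho> i] unfolding rec_rep_def by blast
  then show "rec_rep (\<lambda>j. s j + chip i j) (open_add G z i \<rho>) (m + 1 + chip_count G \<rho> - chip_count G (open_add G z i \<rho>))"
    by (simp add: k_eq algebra_simps)
qed

lemma rec_rep_self: "\<rho> \<in> Rec G z \<Longrightarrow> rec_rep \<rho> \<rho> 0"
  unfolding rec_rep_def by (auto simp: lap_const intro!: exI[of _ "\<lambda>_. 0"])

lemma open_add_sink:
  assumes \<rho>: "\<rho> \<in> Rec G z"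
  shows "open_add G z z \<rho> = \<rho>"
proof -
  have "rec_rep (\<lambda>j. \<rho> j + chip z j) \<rho> 1"
    using \<rho> unfolding rec_rep_def by (auto simp: lap_const intro!: exI[of _ "\<lambda>_. 0"])
  then show ?thesis
    using rec_rep_open_add(1)[OF rec_rep_self[OF \<rho>] z_in_verts] rec_rep_unique by blast
qed

lemma inj_on_open_add:
  assumes i: "i \<in> verts G"
  shows "inj_on (open_add G z i) (Rec G z)"
proof (rule inj_onI)
  fix \<rho> \<rho>' assume \<rho>: "\<rho> \<in> Rec G z" "\<rho>' \<in> Rec G z" and eq: "open_add G z i \<rho> = open_add G z i \<rho>'"
  obtain m where "rec_rep (\<lambda>j. \<rho> j + chip i j) (open_add G z i \<rho>) m"
    using rec_rep_open_add_self[OF \<rho>(1) i] by blast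
  then obtain u where u: "\<And>j. \<rho> j + chip i j = open_add G z i \<rho> j + m * chip z j + lap G u j"
    by (auto simp: rec_rep_def fun_eq_iff)
  obtain m' where "rec_rep (\<lambda>j. \<rho>' j + chip i j) (open_add G z i \<rho>') m'"
    using rec_rep_open_add_self[OF \<rho>(2) i] by blast
  then obtain u' where u': "\<And>j. \<rho>' j + chip i j = open_add G z i \<rho>' j + m' * chip z j + lap G u' j"
    by (auto simp: rec_rep_def fun_eq_iff)
  have "\<rho> j = \<rho>' j + (m - m') * chip z j + lap G (\<lambda>j. u j - u' j) j" for j
    using u[of j] u'[of j] eq by (simp add: lap_diff algebra_simps)
  then have "rec_rep \<rho> \<rho>' (m - m')" using \<rho>(2) unfolding rec_rep_def by blast
  then show "\<rho> = \<rho>'" using rec_rep_unique(1)[OF rec_rep_self[OF \<rho>(1)]] by blast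
qed

lemma bij_betw_open_add:
  assumes i: "i \<in> verts G"
  shows "bij_betw (open_add G z i) (Rec G z) (Rec G z)"
  using inj_on_open_add[OF i] open_add_in_Rec[OF _ i]
  unfolding bij_betw_def by (intro conjI endo_inj_surj finite_Rec) auto

lemma rec_rep_fold_open_add:
  assumes "rec_rep s \<rho> m" "set xs \<subseteq> verts G"
  shows "\<exists>m'. rec_rep (\<lambda>j. s j + int (count_list xs j)) (fold (open_add G z) xs \<rho>) m'"
  using assms
proof (induction xs arbitrary: s \<rho> m)
  case Nil
  then show ?case by auto
next
  case (Cons i xs)
  have "(\<lambda>j. s j + int (count_list (i # xs) j)) = (\<lambda>j. (s j + chip i j) + int (count_list xs j))"
    by (auto simp: chip_def)
  with Cons.IH[OF rec_rep_open_add(1)[OF Cons.prems(1), of i]] Cons.prems(2) show ?case by simp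
qed

text \<open>
  Modulo the Laplacian and \<open>\<delta>\<^sub>z\<close>, the difference \<open>\<sigma> - \<rho>\<close> is represented by a nonnegative function
  \<open>c\<close>; adding these chips one by one leads from \<open>\<rho>\<close> to \<open>\<sigma>\<close> by uniqueness of the decomposition.
\<close>

lemma open_add_transitive:
  assumes \<rho>: "\<rho> \<in> Rec G z" and \<sigma>: "\<sigma> \<in> Rec G z"
  shows "\<exists>xs. set xs \<subseteq> verts G \<and> fold (open_add G z) xs \<rho> = \<sigma>"
proof -
  obtain w where w: "\<forall>i\<in>verts G - {z}. (\<rho> i - \<sigma> i + deg G i) + lap G w i \<le> deg G i - 1"
    using exists_sink_stabilizer[of "\<lambda>i. \<rho> i - \<sigma> i + deg G i"] by blast
  \<comment> \<open>Off the sink \<open>c \<ge> 0\<close> by the choice of \<open>w\<close>; at the sink the absolute value takes care of it.\<close>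
  define c where "c j = \<sigma> j - \<rho> j + \<bar>\<sigma> z - \<rho> z - lap G w z\<bar> * chip z j - lap G w j" for j
  have c: "0 \<le> c j" if "j \<in> verts G" for j
    using bspec[OF w, of j] that by (cases "j = z") (auto simp: c_def chip_def)
  obtain xs where xs: "set xs \<subseteq> verts G" "\<forall>a\<in>verts G. count_list xs a = nat (c a)"
    using exists_list_with_counts[OF finite_verts, of "\<lambda>a. nat (c a)"] by blast
  have "\<rho> j + int (count_list xs j) = \<sigma> j + \<bar>\<sigma> z - \<rho> z - lap G w z\<bar> * chip z j + lap G (\<lambda>j. - w j) j" for j
  proof (cases "j \<in> verts G")
    case True
    then show ?thesis using c[OF True] xs(2) by (simp add: c_def lap_uminus)
  next
    case False
    then have "count_list xs j = 0" using xs(1) by (auto simp: count_list_0_iff)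
    moreover have "\<rho> j = \<sigma> j"
      using \<rho> \<sigma> False by (simp add: Rec_iff vfuns_def PiE_iff extensional_def)
    ultimately show ?thesis using False z_in_verts by (auto simp: lap_outside chip_def)
  qed
  then have "rec_rep (\<lambda>j. \<rho> j + int (count_list xs j)) \<sigma> \<bar>\<sigma> z - \<rho> z - lap G w z\<bar>"
    using \<sigma> unfolding rec_rep_def by blast
  moreover obtain m' where "rec_rep (\<lambda>j. \<rho> j + int (count_list xs j)) (fold (open_add G z) xs \<rho>) m'"
    using rec_rep_fold_open_add[OF rec_rep_self[OF \<rho>] xs(1)] by blast
  ultimately show ?thesis using xs(1) rec_rep_unique(1) by blast
qed

section \<open>The closed chain and its threshold\<close>

lemma rec_rep_add_chip:
  assumes "rec_rep s \<rho> m" "i \<in> verts G"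
  shows "rec_rep (add_chip G i s) (open_add G z i \<rho>) (m + 1 + chip_count G \<rho> - chip_count G (open_add G z i \<rho>))"
proof -
  obtain u where "add_chip G i s = (\<lambda>j. s j + chip i j + lap G u j)"
    by (rule add_chip_eq_add_lap)
  then show ?thesis using rec_rep_add_lap[OF rec_rep_open_add(1)[OF assms]] by simp
qed

lemma rec_rep_closed_chain:
  assumes s0: "rec_rep s\<^sub>0 \<rho>\<^sub>0 m\<^sub>0" and x: "\<And>l. 1 \<le> l \<Longrightarrow> l \<le> k \<Longrightarrow> x l \<in> verts G"
  shows "rec_rep (closed_chain G s\<^sub>0 x k) (fold (open_add G z) (map x [1..<Suc k]) \<rho>\<^sub>0)
    (chip_count G s\<^sub>0 + int k - chip_count G (fold (open_add G z) (map x [1..<Suc k]) \<rho>\<^sub>0))"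
  using x
proof (induction k)
  case 0
  then show ?case using s0 rec_rep_chip_count[OF s0] by simp
next
  case (Suc k)
  have "x (Suc k) \<in> verts G" using Suc.prems by simp
  from rec_rep_add_chip[OF Suc.IH this] Suc.prems show ?case
    by (simp add: algebra_simps)
qed

lemma open_add_inv:
  assumes "\<rho> \<in> Rec G z" "i \<in> verts G"
  shows "open_add_inv G z i \<rho> \<in> Rec G z" "open_add G z i (open_add_inv G z i \<rho>) = \<rho>"
proof -
  have "\<rho> \<in> open_add G z i ` Rec G z" using bij_betw_open_add assms by (simp add: bij_betw_def)
  then show "open_add_inv G z i \<rho> \<in> Rec G z" "open_add G z i (open_add_inv G z i \<rho>) = \<rho>"
    by (simp_all add: open_add_inv_def inv_into_into f_inv_into_f)
qed

lemma open_add_inv_unique: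
  "\<sigma> \<in> Rec G z \<Longrightarrow> i \<in> verts G \<Longrightarrow> open_add G z i \<sigma> = \<rho> \<Longrightarrow> open_add_inv G z i \<rho> = \<sigma>"
  using inj_on_open_add by (auto simp: open_add_inv_def inv_into_f_f)

text \<open>
  In the notation of the proof, \<open>P k\<close> and \<open>L k\<close> are the recurrent part and the sink part of the chain at time
  \<open>k\<close>. The value of \<open>L\<close> at the threshold determines the threshold time. Monotonicity of \<open>L\<close> reduces
  the event to the conditions \<open>L n < 0\<close> and \<open>L (Suc n) = m\<close> on two consecutive times.
\<close>

lemma threshold_event_iff:
  assumes s0: "rec_rep s\<^sub>0 \<rho>\<^sub>0 m\<^sub>0" "chip_count G s\<^sub>0 < 0"
    and x: "\<And>k. 1 \<le> k \<Longrightarrow> x k \<in> verts G"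
    and \<rho>: "\<rho> \<in> Rec G z" and i: "i \<in> verts G"
    and n: "int n = chip_count G \<rho> + int m - chip_count G s\<^sub>0 - 1"
  shows "x (threshold_time G s\<^sub>0 x) = i \<and> rec_part G z (threshold_state G s\<^sub>0 x) = \<rho> \<and>
      sink_part G z (threshold_state G s\<^sub>0 x) = int m \<longleftrightarrow>
    int m \<le> chip_count G (open_add_inv G z i \<rho>) - chip_count G \<rho> \<and>
      x (Suc n) = i \<and> fold (open_add G z) (map x [1..<Suc n]) \<rho>\<^sub>0 = open_add_inv G z i \<rho>"
    (is "?threshold \<longleftrightarrow> ?fixed")
proof -
  define P where "P k = fold (open_add G z) (map x [1..<Suc k]) \<rho>\<^sub>0" for k
  define L where "L k = chip_count G s\<^sub>0 + int k - chip_count G (P k)" for k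
  define \<tau> where "\<tau> = threshold_time G s\<^sub>0 x"
  have rep: "rec_rep (closed_chain G s\<^sub>0 x k) (P k) (L k)" for k
    using rec_rep_closed_chain[OF s0(1), of k x] x by (simp add: P_def L_def)
  then have P_Rec: "P k \<in> Rec G z" for k by (simp add: rec_rep_def)
  have P_Suc: "P (Suc k) = open_add G z (x (Suc k)) (P k)" for k by (simp add: P_def)
  have "L k \<le> L (Suc k)" for k
    using rec_rep_open_add(2)[OF rec_rep_self[OF P_Rec[of k]] x[of "Suc k"]] by (simp add: L_def P_Suc)
  then have mono: "k \<le> l \<Longrightarrow> L k \<le> L l" for k l by (rule lift_Suc_mono_le)
  have L0: "L 0 < 0" using s0(2) chip_count_Rec_nonneg[OF P_Rec[of 0]] by (simp add: L_def)
  define B where "B = Max (chip_count G ` Rec G z)"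
  have B: "chip_count G (P k) \<le> B" for k
    unfolding B_def using finite_Rec P_Rec[of k] by (intro Max_ge) auto
  have "0 \<le> B" using B[of 0] chip_count_Rec_nonneg[OF P_Rec[of 0]] by simp
  then have "\<exists>k. 0 \<le> L k"
    using B[of "nat (B - chip_count G s\<^sub>0)"] s0(2)
    by (intro exI[of _ "nat (B - chip_count G s\<^sub>0)"]) (simp add: L_def)
  moreover have \<tau>_eq: "\<tau> = (LEAST k. 0 \<le> L k)"
    unfolding \<tau>_def threshold_time_def by (simp add: stabilizable_iff_rep[OF rep] not_less)
  ultimately have L\<tau>: "0 \<le> L \<tau>" using LeastI_ex[of "\<lambda>k. 0 \<le> L k"] by simp
  have before: "L k < 0" if "k < \<tau>" for k
    using not_less_Least[of k "\<lambda>k. 0 \<le> L k"] that unfolding \<tau>_eq by simp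
  have state: "rec_part G z (threshold_state G s\<^sub>0 x) = P \<tau>" "sink_part G z (threshold_state G s\<^sub>0 x) = L \<tau>"
    using rec_decomp_of_rep[OF rep[of \<tau>]] by (simp_all add: threshold_state_def \<tau>_def)
  show ?thesis
  proof
    assume ?threshold
    then have t: "x \<tau> = i" "P \<tau> = \<rho>" "L \<tau> = int m" by (simp_all add: state \<tau>_def)
    have "\<tau> \<noteq> 0" using L0 L\<tau> by (cases \<tau>) simp_all
    moreover have "int \<tau> = int (Suc n)" using t(2,3) n by (simp add: L_def)
    ultimately have \<tau>n: "\<tau> = Suc n" by simp
    have Pn: "open_add_inv G z i \<rho> = P n"
      using t(1,2) P_Rec[of n] i unfolding \<tau>n P_Suc by (intro open_add_inv_unique) auto
    have "L n < 0" by (rule before) (simp add: \<tau>n)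
    then show ?fixed using t(1) n Pn by (simp add: \<tau>n L_def P_def)
  next
    assume f: ?fixed
    then have Pn: "P n = open_add_inv G z i \<rho>" and xn: "x (Suc n) = i" by (simp_all add: P_def)
    have P: "P (Suc n) = \<rho>" using open_add_inv(2)[OF \<rho> i] by (simp only: P_Suc xn Pn)
    have Ln: "L n < 0" using f n by (simp add: L_def Pn)
    have LSn: "L (Suc n) = int m" using n by (simp add: L_def P)
    have "\<tau> \<le> Suc n" unfolding \<tau>_eq using LSn by (intro Least_le) simp
    moreover have "\<not> \<tau> \<le> n" using mono[of \<tau> n] Ln L\<tau> by auto
    ultimately have \<tau>n: "\<tau> = Suc n" by simp
    show ?threshold unfolding state using xn P LSn \<tau>n by (simp add: \<tau>_def)
  qed
qed

section \<open>Paths that leave the vertex set\<close>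

lemma legal_cong:
  "(\<And>j. j \<in> verts G \<Longrightarrow> s j = t j) \<Longrightarrow> legal G Z s is = legal G Z t is"
proof (induction "is" arbitrary: s t)
  case (Cons i "is")
  then have "legal G Z (topple G Z i s) is = legal G Z (topple G Z i t) is"
    by (intro Cons.IH) (simp add: topple_def)
  then show ?case using Cons.prems by auto
qed simp

text \<open>
  What a step does on the vertices depends only on what is seen on the vertices; in particular, all drivers
  outside the vertex set have the same effect there.
\<close>

lemma add_chip_cong:
  assumes eq: "\<And>j. j \<in> verts G \<Longrightarrow> s j + chip i j = t j + chip i' j" and j: "j \<in> verts G"
  shows "add_chip G i s j = add_chip G i' t j"
proof -
  let ?s = "\<lambda>j. s j + chip i j" and ?t = "\<lambda>j. t j + chip i' j"
  have st: "stabilizable G ?s = stabilizable G ?t" unfolding stabilizable_iff using eq by simp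
  show ?thesis
  proof (cases "stabilizable G ?s")
    case True
    then obtain "is" where xs: "stabilizing G {} ?s is" by (auto simp: stabilizable_def)
    then have xt: "stabilizing G {} ?t is"
      using eq legal_cong[of ?s ?t "{}" "is"] by (simp add: stabilizing_def stable_def fold_topple)
    show ?thesis
      using True st stabilization_eq[OF xs] stabilization_eq[OF xt] eq[OF j]
      by (simp add: add_chip_def Let_def fold_topple)
  next
    case False
    then show ?thesis using st eq[OF j] by (simp add: add_chip_def Let_def)
  qed
qed

text \<open>
  Chips dropped outside the vertex set stay there. Hence a path that has left the vertex set once never
  returns to extensional sandpiles.
\<close>

lemma closed_chain_outside:
  assumes "j \<notin> verts G"
  shows "closed_chain G s\<^sub>0 x k j = s\<^sub>0 j + int (count_list (map x [1..<Suc k]) j)"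
proof (induction k)
  case (Suc k)
  obtain u where "add_chip G (x (Suc k)) (closed_chain G s\<^sub>0 x k) =
      (\<lambda>j. closed_chain G s\<^sub>0 x k j + chip (x (Suc k)) j + lap G u j)"
    by (rule add_chip_eq_add_lap)
  then show ?case using Suc assms by (simp add: lap_outside chip_def)
qed simp

lemma closed_chain_in_vfuns_iff:
  assumes "s\<^sub>0 \<in> vfuns G"
  shows "closed_chain G s\<^sub>0 x k \<in> vfuns G \<longleftrightarrow> (\<forall>l\<in>{1..k}. x l \<in> verts G)"
proof -
  have "closed_chain G s\<^sub>0 x k \<in> vfuns G \<longleftrightarrow> (\<forall>j. j \<notin> verts G \<longrightarrow> count_list (map x [1..<Suc k]) j = 0)"
    using assms by (auto simp: vfuns_def PiE_iff extensional_def closed_chain_outside)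
  also have "\<dots> \<longleftrightarrow> (\<forall>l\<in>{1..k}. x l \<in> verts G)"
    by (simp only: count_list_0_iff set_map set_upt atLeastLessThanSuc_atLeastAtMost) blast
  finally show ?thesis .
qed

text \<open>
  Outside the extensional functions the description defining \<open>rec_decomp\<close> is never satisfied, so its value
  there is one and the same unspecified triple.
\<close>

lemma rec_decomp_outside:
  assumes "s \<notin> vfuns G" "t \<notin> vfuns G"
  shows "rec_decomp G z s = rec_decomp G z t"
proof -
  have "rec_decomp G z r = (THE p. False)" if "r \<notin> vfuns G" for r
  proof -
    have "\<not> (\<rho> \<in> Rec G z \<and> v \<in> vfuns G \<and> v z = 0 \<and> r = (\<lambda>j. \<rho> j + m * chip z j + lap G v j))"
      for \<rho> m v
      using rec_rep_in_vfuns[of r \<rho> m] that unfolding rec_rep_def by blast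
    then show ?thesis unfolding rec_decomp_def by (intro arg_cong[of _ _ The]) (simp add: fun_eq_iff)
  qed
  then show ?thesis using assms by simp
qed

end

section \<open>The law at the threshold\<close>

locale driven_sandpile = sandpile_sink G z + prob_space M
  for G :: "('v, 'e) pre_digraph" and z :: 'v and M :: "'w measure" +
  fixes \<alpha> :: "'v pmf" and X :: "nat \<Rightarrow> 'w \<Rightarrow> 'v"
  assumes \<alpha>_support: "set_pmf \<alpha> \<subseteq> verts G"
    and \<alpha>_pos: "\<And>i. i \<in> verts G \<Longrightarrow> 0 < pmf \<alpha> i"
    and X_indep: "indep_vars (\<lambda>_. count_space UNIV) X {1..}"
    and X_law: "\<And>k. 1 \<le> k \<Longrightarrow> distr M (count_space UNIV) (X k) = measure_pmf \<alpha>"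
begin

sublocale walk: permutation_walk "verts G" "pmf \<alpha>" "Rec G z" "open_add G z" z
  by unfold_locales
    (use \<alpha>_pos \<alpha>_support finite_Rec Rec_nonempty bij_betw_open_add open_add_transitive z_in_verts open_add_sink
      in \<open>auto intro!: sum_pmf_eq_1\<close>)

lemma X_measurable: "1 \<le> k \<Longrightarrow> X k \<in> measurable M (count_space UNIV)"
  using X_indep by (auto simp: indep_vars_def)

lemma AE_X_in_verts: "AE \<omega> in M. \<forall>k\<ge>1. X k \<omega> \<in> verts G"
proof -
  have "AE \<omega> in M. X k \<omega> \<in> verts G" if "1 \<le> k" for k
  proof -
    have "AE i in measure_pmf \<alpha>. i \<in> verts G" using \<alpha>_support by (auto simp: AE_measure_pmf_iff)
    then have "AE i in distr M (count_space UNIV) (X k). i \<in> verts G" by (simp only: X_law[OF that])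
    then show ?thesis by (rule AE_distrD[OF X_measurable[OF that]])
  qed
  then have "AE \<omega> in M. 1 \<le> k \<longrightarrow> X k \<omega> \<in> verts G" for k by (cases "1 \<le> k") auto
  then show ?thesis by (simp add: AE_all_countable)
qed

definition word_event :: "'v list \<Rightarrow> 'w set" where
  "word_event xs = {\<omega> \<in> space M. map (\<lambda>k. X k \<omega>) [1..<Suc (length xs)] = xs}"

lemma word_event_eq:
  "word_event xs = {\<omega> \<in> space M. \<forall>k\<in>{1..length xs}. X k \<omega> = xs ! (k - 1)}"
proof -
  have "map f [1..<Suc (length xs)] = xs \<longleftrightarrow> (\<forall>k\<in>{1..length xs}. f k = xs ! (k - 1))" for f :: "nat \<Rightarrow> 'v"
  proof
    assume eq: "map f [1..<Suc (length xs)] = xs"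
    show "\<forall>k\<in>{1..length xs}. f k = xs ! (k - 1)"
    proof
      fix k assume k: "k \<in> {1..length xs}"
      have "map f [1..<Suc (length xs)] ! (k - 1) = f k" 
      proof -
        have "k - 1 < length [1..<Suc (length xs)]" "[1..<Suc (length xs)] ! (k - 1) = k"
          using k by (auto simp: nth_upt simp del: upt_Suc)
        then show ?thesis by (simp only: nth_map)
      qed
      then show "f k = xs ! (k - 1)" by (simp only: eq)
    qed
  next
    assume eq: "\<forall>k\<in>{1..length xs}. f k = xs ! (k - 1)"
    show "map f [1..<Suc (length xs)] = xs"
    proof (rule nth_equalityI)
      fix k assume "k < length (map f [1..<Suc (length xs)])"
      then have k: "k < length xs" by (simp del: upt_Suc)
      then have "map f [1..<Suc (length xs)] ! k = f (Suc k)"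
        by (subst nth_map) (simp_all add: nth_upt del: upt_Suc)
      also have "\<dots> = xs ! k" using bspec[OF eq, of "Suc k"] k by simp
      finally show "map f [1..<Suc (length xs)] ! k = xs ! k" .
    qed (simp del: upt_Suc)
  qed
  then show ?thesis by (simp add: word_event_def)
qed

lemma word_event_sets: "word_event xs \<in> sets M"
proof -
  have "X k -` {xs ! (k - 1)} \<inter> space M \<in> sets M" if "k \<in> {1..length xs}" for k
    using that by (intro measurable_sets[OF X_measurable]) auto
  then have "{\<omega> \<in> space M. X k \<omega> = xs ! (k - 1)} \<in> sets M" if "k \<in> {1..length xs}" for k
    using that by (simp add: vimage_def Int_def conj_commute)
  then show ?thesis unfolding word_event_eq by (intro sets.sets_Collect_finite_All) auto
qed

lemma prob_word_event: "prob (word_event xs) = prod_list (map (pmf \<alpha>) xs)"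
proof (cases "xs = []")
  case True
  then show ?thesis by (simp add: word_event_def prob_space)
next
  case False
  let ?J = "{1..length xs}"
  have "word_event xs = (\<Inter>k\<in>?J. X k -` {xs ! (k - 1)} \<inter> space M)"
    using False by (auto simp: word_event_eq Suc_le_eq)
  also have "prob \<dots> = (\<Prod>k\<in>?J. prob (X k -` {xs ! (k - 1)} \<inter> space M))"
    using False by (intro indep_varsD[OF X_indep]) (auto simp: Suc_le_eq)
  also have "\<dots> = (\<Prod>k\<in>?J. pmf \<alpha> (xs ! (k - 1)))"
  proof (rule prod.cong)
    fix k assume "k \<in> ?J"
    then have k: "1 \<le> k" by simp
    have "prob (X k -` {xs ! (k - 1)} \<inter> space M) = measure (distr M (count_space UNIV) (X k)) {xs ! (k - 1)}"
      by (rule measure_distr[symmetric, OF X_measurable[OF k]]) simp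
    then show "prob (X k -` {xs ! (k - 1)} \<inter> space M) = pmf \<alpha> (xs ! (k - 1))"
      by (simp add: X_law[OF k] measure_pmf_single)
  qed simp
  also have "\<dots> = (\<Prod>k<length xs. pmf \<alpha> (xs ! k))"
    using prod.atLeast1_atMost_eq[of "\<lambda>k. pmf \<alpha> (xs ! (k - 1))" "length xs"] by simp
  also have "\<dots> = prod_list (map (pmf \<alpha>) xs)"
    by (simp add: prod.list_conv_set_nth atLeast0LessThan)
  finally show ?thesis .
qed

definition step_event :: "('v \<Rightarrow> int) \<Rightarrow> nat \<Rightarrow> 'v \<Rightarrow> ('v \<Rightarrow> int) \<Rightarrow> 'w set" where
  "step_event \<rho> n i \<sigma> = {\<omega> \<in> space M. (\<forall>k\<in>{1..n}. X k \<omega> \<in> verts G) \<and> X (Suc n) \<omega> = i \<and>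
     fold (open_add G z) (map (\<lambda>k. X k \<omega>) [1..<Suc n]) \<rho> = \<sigma>}"

text \<open>
  The event is a finite disjoint union of events that prescribe the first \<open>n + 1\<close> drivers, and
  independence turns its probability into a sum over words.
\<close>

lemma step_event_prob:
  shows "step_event \<rho> n i \<sigma> \<in> sets M" (is ?sets)
    and "prob (step_event \<rho> n i \<sigma>) = pmf \<alpha> i * walk.visit_prob \<sigma> n \<rho>" (is ?prob)
proof -
  define W where "W = {xs. set xs \<subseteq> verts G \<and> length xs = n}"
  have finW: "finite W" unfolding W_def by (rule finite_lists_length_eq) simp
  let ?W' = "{xs \<in> W. fold (open_add G z) xs \<rho> = \<sigma>}"
  have snoc: "map f [1..<Suc (Suc n)] = map f [1..<Suc n] @ [f (Suc n)]" for f :: "nat \<Rightarrow> 'v" by simp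
  have eq: "step_event \<rho> n i \<sigma> = (\<Union>xs\<in>?W'. word_event (xs @ [i]))"
  proof (intro set_eqI iffI)
    fix \<omega> assume "\<omega> \<in> step_event \<rho> n i \<sigma>"
    then have \<omega>: "\<omega> \<in> space M" "\<forall>k\<in>{1..n}. X k \<omega> \<in> verts G" "X (Suc n) \<omega> = i"
      "fold (open_add G z) (map (\<lambda>k. X k \<omega>) [1..<Suc n]) \<rho> = \<sigma>"
      by (simp_all add: step_event_def)
    have "map (\<lambda>k. X k \<omega>) [1..<Suc n] \<in> ?W'"
      using \<omega>(2,4) by (auto simp: W_def simp del: upt_Suc)
    moreover have "\<omega> \<in> word_event (map (\<lambda>k. X k \<omega>) [1..<Suc n] @ [i])"
      using \<omega>(1,3) snoc by (simp add: word_event_def del: upt_Suc)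
    ultimately show "\<omega> \<in> (\<Union>xs\<in>?W'. word_event (xs @ [i]))" by blast
  next
    fix \<omega> assume "\<omega> \<in> (\<Union>xs\<in>?W'. word_event (xs @ [i]))"
    then obtain xs where xs: "set xs \<subseteq> verts G" "length xs = n" "fold (open_add G z) xs \<rho> = \<sigma>"
      "\<omega> \<in> space M" "map (\<lambda>k. X k \<omega>) [1..<Suc n] @ [X (Suc n) \<omega>] = xs @ [i]"
      by (auto simp: word_event_def W_def)
    then have *: "map (\<lambda>k. X k \<omega>) [1..<Suc n] = xs" "X (Suc n) \<omega> = i" by auto
    have "X k \<omega> \<in> verts G" if "k \<in> {1..n}" for k
    proof -
      have "X k \<omega> \<in> set (map (\<lambda>k. X k \<omega>) [1..<Suc n])"
        using that by (auto simp del: upt_Suc)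
      then show ?thesis using xs(1) unfolding *(1) by blast
    qed
    then show "\<omega> \<in> step_event \<rho> n i \<sigma>" using xs * by (simp add: step_event_def)
  qed
  show ?sets unfolding eq using finW word_event_sets by (intro sets.finite_UN) auto
  have "prob (step_event \<rho> n i \<sigma>) = (\<Sum>xs\<in>?W'. prob (word_event (xs @ [i])))"
    unfolding eq
  proof (rule finite_measure_finite_Union)
    show "disjoint_family_on (\<lambda>xs. word_event (xs @ [i])) ?W'"
      by (auto simp: disjoint_family_on_def word_event_def W_def)
  qed (use finW word_event_sets in auto)
  also have "\<dots> = (\<Sum>xs\<in>W. if fold (open_add G z) xs \<rho> = \<sigma> then pmf \<alpha> i * prod_list (map (pmf \<alpha>) xs) else 0)"
    by (simp add: prob_word_event sum.inter_filter[OF finW] mult.commute)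
  also have "\<dots> = pmf \<alpha> i * walk.visit_prob \<sigma> n \<rho>"
    unfolding walk.visit_prob_eq_sum_words W_def[symmetric] sum_distrib_left
    by (intro sum.cong) auto
  finally show ?prob .
qed

definition chain_on_verts :: "('v \<Rightarrow> int) \<Rightarrow> nat \<Rightarrow> 'w \<Rightarrow> 'v \<Rightarrow> int" where
  "chain_on_verts s\<^sub>0 k \<omega> = restrict (closed_chain G s\<^sub>0 (\<lambda>k. X k \<omega>) k) (verts G)"

text \<open>
  On the vertices, each step depends on the driver only through a variable with finitely many values,
  in which all drivers outside the vertex set are identified. The type of the vertices may be uncountable,
  and a function of several discrete variables need not be measurable then; the finiteness avoids this.
\<close>

lemma chain_on_verts_measurable: "chain_on_verts s\<^sub>0 k \<in> measurable M (count_space UNIV)"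
proof (induction k)
  case 0
  then show ?case by (simp add: chain_on_verts_def)
next
  case (Suc k)
  define Y where "Y \<omega> = (if X (Suc k) \<omega> \<in> verts G then Some (X (Suc k) \<omega>) else None)" for \<omega>
  \<comment> \<open>A representative of all drivers outside the vertex set; it is arbitrary if there are none.\<close>
  define p where "p = (SOME p. p \<notin> verts G)"
  define F where "F y r = restrict (add_chip G (case y of Some i \<Rightarrow> i | None \<Rightarrow> p) r) (verts G)" for y r
  have step: "chain_on_verts s\<^sub>0 (Suc k) \<omega> = F (Y \<omega>) (chain_on_verts s\<^sub>0 k \<omega>)" for \<omega>
  proof -
    have "p \<notin> verts G" if "X (Suc k) \<omega> \<notin> verts G"
      unfolding p_def using that by (rule someI)
    then show ?thesis
      unfolding chain_on_verts_def F_def closed_chain.simps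
      by (intro restrict_ext add_chip_cong) (auto simp: Y_def chip_def)
  qed
  have "Y \<in> measurable M (count_space (insert None (Some ` verts G)))"
    unfolding Y_def by (rule measurable_compose[OF X_measurable]) (auto simp: measurable_count_space_eq1)
  then have "(\<lambda>\<omega>. F (Y \<omega>) (chain_on_verts s\<^sub>0 k \<omega>)) \<in> measurable M (count_space UNIV)"
    by (rule measurable_compose_countable'[rotated])
      (auto intro: measurable_compose[OF Suc] countable_finite)
  then show ?case by (simp add: step)
qed

lemma threshold_time_measurable:
  "(\<lambda>\<omega>. threshold_time G s\<^sub>0 (\<lambda>k. X k \<omega>)) \<in> measurable M (count_space UNIV)"
proof -
  have "stabilizable G (closed_chain G s\<^sub>0 (\<lambda>k. X k \<omega>) k) = stabilizable G (chain_on_verts s\<^sub>0 k \<omega>)" for \<omega> k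
    by (simp add: stabilizable_iff chain_on_verts_def)
  moreover have "(\<lambda>\<omega>. \<not> stabilizable G (chain_on_verts s\<^sub>0 k \<omega>)) \<in> measurable M (count_space UNIV)" for k
    by (rule measurable_compose[OF chain_on_verts_measurable]) simp
  ultimately show ?thesis unfolding threshold_time_def by (simp add: measurable_Least)
qed

definition threshold_event :: "('v \<Rightarrow> int) \<Rightarrow> 'v \<Rightarrow> ('v \<Rightarrow> int) \<Rightarrow> int \<Rightarrow> 'w set" where
  "threshold_event s\<^sub>0 i \<rho> m = {\<omega> \<in> space M.
          X (threshold_time G s\<^sub>0 (\<lambda>k. X k \<omega>)) \<omega> = i \<and>
          rec_part G z (threshold_state G s\<^sub>0 (\<lambda>k. X k \<omega>)) = \<rho> \<and>
          sink_part G z (threshold_state G s\<^sub>0 (\<lambda>k. X k \<omega>)) = m}"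

text \<open>
  As long as the path stays among the vertices, the event is expressed by \<open>chain_on_verts\<close>. Once
  the path has left them, the decomposition is constant, and what remains is a condition on the
  threshold time and one driver. The hypothesis on \<open>s\<^sub>0\<close> excludes the threshold time \<open>0\<close>, which would
  involve the arbitrary map \<open>X 0\<close>.
\<close>

lemma threshold_event_sets:
  assumes s0: "s\<^sub>0 \<in> vfuns G" "sink_part G z s\<^sub>0 \<noteq> m"
  shows "threshold_event s\<^sub>0 i \<rho> m \<in> sets M"
proof -
  define Q where "Q s \<longleftrightarrow> rec_part G z s = \<rho> \<and> sink_part G z s = m" for s
  define junk where "junk = (SOME s. s \<notin> vfuns G)"
  have junk: "Q s = Q junk" if "s \<notin> vfuns G" for s
  proof -
    have "junk \<notin> vfuns G" unfolding junk_def by (rule someI[of "\<lambda>s. s \<notin> vfuns G", OF that])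
    then show ?thesis using rec_decomp_outside[OF that] by (simp add: Q_def rec_part_def sink_part_def)
  qed
  have restr: "chain_on_verts s\<^sub>0 n \<omega> = closed_chain G s\<^sub>0 (\<lambda>k. X k \<omega>) n"
    if "closed_chain G s\<^sub>0 (\<lambda>k. X k \<omega>) n \<in> vfuns G" for n \<omega>
    using that by (simp add: chain_on_verts_def vfuns_def PiE_iff extensional_restrict)
  have Q: "Q (closed_chain G s\<^sub>0 (\<lambda>k. X k \<omega>) n) \<longleftrightarrow>
      (if \<forall>l\<in>{1..n}. X l \<omega> \<in> verts G then Q (chain_on_verts s\<^sub>0 n \<omega>) else Q junk)" for n \<omega>
    using junk restr closed_chain_in_vfuns_iff[OF s0(1), of "\<lambda>k. X k \<omega>" n] by auto
  define A where "A n = {\<omega> \<in> space M. threshold_time G s\<^sub>0 (\<lambda>k. X k \<omega>) = n \<and> X n \<omega> = i \<and>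
      (if \<forall>l\<in>{1..n}. X l \<omega> \<in> verts G then Q (chain_on_verts s\<^sub>0 n \<omega>) else Q junk)}" for n
  have A_closed_chain: "A n = {\<omega> \<in> space M. threshold_time G s\<^sub>0 (\<lambda>k. X k \<omega>) = n \<and> X n \<omega> = i \<and>
      Q (closed_chain G s\<^sub>0 (\<lambda>k. X k \<omega>) n)}" for n
    unfolding A_def Q ..
  have "threshold_event s\<^sub>0 i \<rho> m = (\<Union>n\<in>{1..}. A n)"
  proof (intro set_eqI iffI)
    fix \<omega> assume "\<omega> \<in> threshold_event s\<^sub>0 i \<rho> m"
    then have \<omega>: "\<omega> \<in> space M" "X (threshold_time G s\<^sub>0 (\<lambda>k. X k \<omega>)) \<omega> = i"
      "Q (closed_chain G s\<^sub>0 (\<lambda>k. X k \<omega>) (threshold_time G s\<^sub>0 (\<lambda>k. X k \<omega>)))"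
      by (simp_all add: threshold_event_def threshold_state_def Q_def)
    have "threshold_time G s\<^sub>0 (\<lambda>k. X k \<omega>) \<noteq> 0"
      using \<omega>(3) s0(2) by (metis Q_def closed_chain.simps(1))
    with \<omega> show "\<omega> \<in> (\<Union>n\<in>{1..}. A n)"
      by (intro UN_I[of "threshold_time G s\<^sub>0 (\<lambda>k. X k \<omega>)"]) (simp_all add: A_closed_chain)
  next
    fix \<omega> assume "\<omega> \<in> (\<Union>n\<in>{1..}. A n)"
    then show "\<omega> \<in> threshold_event s\<^sub>0 i \<rho> m"
      by (auto simp: A_closed_chain threshold_event_def threshold_state_def Q_def)
  qed
  moreover have "A n \<in> sets M" if "n \<in> {1..}" for n
  proof -
    have [measurable]: "Measurable.pred M (\<lambda>\<omega>. threshold_time G s\<^sub>0 (\<lambda>k. X k \<omega>) = n)"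
      by (rule measurable_compose[OF threshold_time_measurable]) simp
    have [measurable]: "Measurable.pred M (\<lambda>\<omega>. X n \<omega> = i)"
      by (rule measurable_compose[OF X_measurable]) (use that in simp_all)
    have [measurable]: "Measurable.pred M (\<lambda>\<omega>. Q (chain_on_verts s\<^sub>0 n \<omega>))"
      by (rule measurable_compose[OF chain_on_verts_measurable]) simp
    have "Measurable.pred M (\<lambda>\<omega>. X l \<omega> \<in> verts G)" if "l \<in> {1..n}" for l
      by (rule measurable_compose[OF X_measurable]) (use that in simp_all)
    then have [measurable]: "Measurable.pred M (\<lambda>\<omega>. \<forall>l\<in>{1..n}. X l \<omega> \<in> verts G)"
      by (intro pred_intros_finite) auto
    show ?thesis unfolding A_def by measurable
  qed
  ultimately show ?thesis by (auto intro: sets.countable_UN')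
qed

text \<open>
  On the paths that stay in the vertex set, hence almost surely, the threshold event coincides with an event
  at the fixed times \<open>n\<close> and \<open>n + 1\<close>.
\<close>

lemma prob_threshold_event:
  assumes s0: "rec_rep s\<^sub>0 \<rho>\<^sub>0 m\<^sub>0" "chip_count G s\<^sub>0 < 0" and \<rho>: "\<rho> \<in> Rec G z" and i: "i \<in> verts G"
    and n: "int n = chip_count G \<rho> + int m - chip_count G s\<^sub>0 - 1"
  shows "prob (threshold_event s\<^sub>0 i \<rho> (int m)) =
    (if int m \<le> chip_count G (open_add_inv G z i \<rho>) - chip_count G \<rho>
     then pmf \<alpha> i * walk.visit_prob (open_add_inv G z i \<rho>) n \<rho>\<^sub>0 else 0)"
proof -
  let ?le = "int m \<le> chip_count G (open_add_inv G z i \<rho>) - chip_count G \<rho>"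
  let ?E = "if ?le then step_event \<rho>\<^sub>0 n i (open_add_inv G z i \<rho>) else {}"
  have "\<rho>\<^sub>0 \<in> Rec G z" using s0(1) by (simp add: rec_rep_def)
  then have "m\<^sub>0 < 0" using rec_rep_chip_count[OF s0(1)] s0(2) chip_count_Rec_nonneg[of \<rho>\<^sub>0] by simp
  then have "threshold_event s\<^sub>0 i \<rho> (int m) \<in> sets M"
    using rec_rep_in_vfuns[OF s0(1)] rec_decomp_of_rep[OF s0(1)] by (intro threshold_event_sets) auto
  moreover have "?E \<in> sets M" using step_event_prob(1) by simp
  moreover have "AE \<omega> in M. \<omega> \<in> threshold_event s\<^sub>0 i \<rho> (int m) \<longleftrightarrow> \<omega> \<in> ?E"
    using AE_X_in_verts
  proof (rule AE_mp, intro AE_I2 impI)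
    fix \<omega> assume "\<omega> \<in> space M" and x: "\<forall>k\<ge>1. X k \<omega> \<in> verts G"
    then show "\<omega> \<in> threshold_event s\<^sub>0 i \<rho> (int m) \<longleftrightarrow> \<omega> \<in> ?E"
      using threshold_event_iff[OF s0 _ \<rho> i n, of "\<lambda>k. X k \<omega>"]
      by (auto simp: threshold_event_def step_event_def)
  qed
  ultimately have "prob (threshold_event s\<^sub>0 i \<rho> (int m)) = prob ?E" by (intro measure_eq_AE)
  then show ?thesis by (simp add: step_event_prob(2))
qed

text \<open>
  Since recurrent sandpiles have nonnegative mass, \<open>n \<ge> - |s\<^sub>0| - 1\<close>, and a sufficiently negative
  \<open>|s\<^sub>0|\<close> leaves the walk enough time to mix, uniformly in the target state.
\<close>

theorem threshold_law:
  assumes "0 < \<epsilon>"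
  shows "\<exists>K<0. \<forall>s\<^sub>0\<in>vfuns G. chip_count G s\<^sub>0 < K \<longrightarrow>
    (\<forall>i\<in>verts G. \<forall>\<rho>\<in>Rec G z. \<forall>m::nat. \<bar>prob (threshold_event s\<^sub>0 i \<rho> (int m))
       - (if int m \<le> chip_count G (open_add_inv G z i \<rho>) - chip_count G \<rho>
          then pmf \<alpha> i / real (card (Rec G z)) else 0)\<bar> \<le> \<epsilon>)"
proof -
  obtain n0 where n0: "\<And>n \<sigma> \<rho>. n0 \<le> n \<Longrightarrow> \<sigma> \<in> Rec G z \<Longrightarrow> \<rho> \<in> Rec G z \<Longrightarrow>
      \<bar>walk.visit_prob \<sigma> n \<rho> - 1 / card (Rec G z)\<bar> \<le> \<epsilon>"
    using walk.visit_prob_tendsto_uniform[OF assms] by blast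
  show ?thesis
  proof (intro exI[of _ "- int n0 - 1"] conjI ballI impI allI)
    fix s\<^sub>0 i \<rho> and m :: nat
    assume s0: "s\<^sub>0 \<in> vfuns G" "chip_count G s\<^sub>0 < - int n0 - 1" and i: "i \<in> verts G" and \<rho>: "\<rho> \<in> Rec G z"
    obtain \<rho>\<^sub>0 m\<^sub>0 where rep: "rec_rep s\<^sub>0 \<rho>\<^sub>0 m\<^sub>0" using exists_rec_rep[OF s0(1)] by blast
    define n where "n = nat (chip_count G \<rho> + int m - chip_count G s\<^sub>0 - 1)"
    have nn: "int n = chip_count G \<rho> + int m - chip_count G s\<^sub>0 - 1" "n0 \<le> n"
      using s0(2) chip_count_Rec_nonneg[OF \<rho>] by (auto simp: n_def)
    let ?v = "walk.visit_prob (open_add_inv G z i \<rho>) n \<rho>\<^sub>0" and ?c = "real (card (Rec G z))"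
    have "\<bar>?v - 1 / ?c\<bar> \<le> \<epsilon>"
      using n0[OF nn(2) open_add_inv(1)[OF \<rho> i]] rep by (simp add: rec_rep_def)
    then have "pmf \<alpha> i * \<bar>?v - 1 / ?c\<bar> \<le> 1 * \<epsilon>" using assms by (intro mult_mono pmf_le_1) auto
    moreover have "pmf \<alpha> i * ?v - pmf \<alpha> i / ?c = pmf \<alpha> i * (?v - 1 / ?c)" by (simp add: algebra_simps)
    ultimately have "\<bar>pmf \<alpha> i * ?v - pmf \<alpha> i / ?c\<bar> \<le> \<epsilon>" by (simp add: abs_mult)
    then show "\<bar>prob (threshold_event s\<^sub>0 i \<rho> (int m))
       - (if int m \<le> chip_count G (open_add_inv G z i \<rho>) - chip_count G \<rho>
          then pmf \<alpha> i / real (card (Rec G z)) else 0)\<bar> \<le> \<epsilon>"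
      using prob_threshold_event[OF rep _ \<rho> i nn(1)] s0(2) assms by simp
  qed simp
qed

end

theorem theorem2:
  fixes G :: "('v, 'e) pre_digraph" and z :: 'v and \<alpha> :: "'v pmf"
    and M :: "'w measure" and X :: "nat \<Rightarrow> 'w \<Rightarrow> 'v"
  assumes "fin_digraph G"
    and "Digraph_Component.connected G"
    and "eulerian G"
    and "z \<in> verts G"
    and "set_pmf \<alpha> \<subseteq> verts G"
    and "\<forall>i\<in>verts G. 0 < pmf \<alpha> i"
    and "prob_space M"
    and "prob_space.indep_vars M (\<lambda>_. count_space UNIV) X {1..}"
    and "\<forall>k\<ge>1. distr M (count_space UNIV) (X k) = measure_pmf \<alpha>"
  shows "\<forall>\<epsilon>>0. \<exists>K<0. \<forall>s\<^sub>0\<in>vfuns G. chip_count G s\<^sub>0 < K \<longrightarrow>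
    (\<forall>i\<in>verts G. \<forall>\<rho>\<in>Rec G z. \<forall>m::nat.
      \<bar>measure M {\<omega> \<in> space M.
          X (threshold_time G s\<^sub>0 (\<lambda>k. X k \<omega>)) \<omega> = i \<and>
          rec_part G z (threshold_state G s\<^sub>0 (\<lambda>k. X k \<omega>)) = \<rho> \<and>
          sink_part G z (threshold_state G s\<^sub>0 (\<lambda>k. X k \<omega>)) = int m}
       - (if int m \<le> chip_count G (open_add_inv G z i \<rho>) - chip_count G \<rho>
          then pmf \<alpha> i / real (card (Rec G z)) else 0)\<bar> \<le> \<epsilon>)"
proof -
  interpret fin_digraph G by fact
  interpret prob_space M by fact
  interpret driven_sandpile G z M \<alpha> X
    by unfold_locales (use assms in auto)
  show ?thesis
    using threshold_law unfolding threshold_event_def by blast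
qed

end
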